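(* Let $\chi$ be a non-principal Dirichlet character of modulus $k$, and for $\chi(n)\neq 0$ write $\chi(n)=e^{i\theta_n}$. Let $(r_n)_{n\ge 3}$ be independent random variables, each uniformly distributed on $[0,1]$. Define the random set $\mathbb{P}'=\{n\ge 3:\ r_n\le 1/\log n\}$ with elements $p'_1<p'_2<\cdots$, and for $n\ge 3$ set $z_{n,k}=1$ if $r_n\le 1/\log n$ and $\gcd(n,k)=1$, and $z_{n,k}=0$ otherwise. Define $$C'_N=\sum_{n=3}^{p'_N} z_{n,k}\cos\theta_n .$$ Then, as $N\to\infty$, $$\sqrt{\frac{1+\frac{\log\log N}{\log N}}{s^2 N}}\; C'_N \ \xrightarrow{d}\ \mathcal{N}(0,1),$$ where $s^2=a\,\varphi(k)/k$, with $a=1$ if all values of $\chi$ are real (i.e. all nonzero values are $\pm1$) and $a=1/2$ otherwise, $\varphi$ is Euler's totient function, and $\mathcal{N}(0,1)$ is the standard normal distribution.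
   Context: This is a variant of Cramér's random model for the primes: each integer $n\ge3$ is declared a "pseudo-prime" independently with probability $1/\log n$. The terms with $z_{n,k}=0$ contribute nothing, so $\cos\theta_n$ need only be defined when $\gcd(n,k)=1$. Convergence $\xrightarrow{d}$ is convergence in distribution. *)

theory Defs
  imports "HOL-Probability.Probability" "HOL-Number_Theory.Totient"
begin

text \<open>Dirichlet characters modulo \<open>k\<close>, viewed as arithmetic functions on the natural
  numbers and extended by 0 to arguments that are not coprime to \<open>k\<close>.\<close>

definition dirichlet_character :: "nat \<Rightarrow> (nat \<Rightarrow> complex) \<Rightarrow> bool" where
  "dirichlet_character k chi \<longleftrightarrow>
     k > 0 \<and>
     (\<forall>m n. chi (m * n) = chi m * chi n) \<and>
     (\<forall>n. chi (n + k) = chi n) \<and>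
     (\<forall>n. chi n \<noteq> 0 \<longleftrightarrow> coprime n k)"

definition principal_character :: "nat \<Rightarrow> nat \<Rightarrow> complex" where
  "principal_character k n = (if coprime n k then 1 else 0)"

definition pseudo_primes :: "(nat \<Rightarrow> 'a \<Rightarrow> real) \<Rightarrow> 'a \<Rightarrow> nat set" where
  "pseudo_primes r \<omega> = {n. n \<ge> 3 \<and> r n \<omega> \<le> 1 / ln (real n)}"

text \<open>The pseudo-primes are counted from \<open>N = 1\<close>, whereas \<^const>\<open>enumerate\<close> counts from 0.
  The value is only meaningful if there are at least \<open>N\<close> pseudo-primes.\<close>

definition nth_pseudo_prime :: "(nat \<Rightarrow> 'a \<Rightarrow> real) \<Rightarrow> nat \<Rightarrow> 'a \<Rightarrow> nat" where
  "nth_pseudo_prime r N \<omega> = enumerate (pseudo_primes r \<omega>) (N - 1)"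

definition pseudo_prime_coprime_ind :: "(nat \<Rightarrow> 'a \<Rightarrow> real) \<Rightarrow> nat \<Rightarrow> nat \<Rightarrow> 'a \<Rightarrow> real" where
  "pseudo_prime_coprime_ind r k n \<omega> = (if r n \<omega> \<le> 1 / ln (real n) \<and> coprime n k then 1 else 0)"

definition pseudo_prime_cos_sum ::
    "(nat \<Rightarrow> 'a \<Rightarrow> real) \<Rightarrow> nat \<Rightarrow> (nat \<Rightarrow> real) \<Rightarrow> nat \<Rightarrow> 'a \<Rightarrow> real" where
  "pseudo_prime_cos_sum r k \<theta> N \<omega> =
     (\<Sum>n = 3..nth_pseudo_prime r N \<omega>. pseudo_prime_coprime_ind r k n \<omega> * cos (\<theta> n))"

definition character_variance :: "nat \<Rightarrow> (nat \<Rightarrow> complex) \<Rightarrow> real" where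
  "character_variance k chi =
     (if \<forall>n. chi n \<in> \<real> then 1 else 1 / 2) * real (totient k) / real k"

end

theory Submission
  imports Defs "HOL-Real_Asymp.Real_Asymp"
begin

text \<open>The summands of \<open>C'\<^sub>N\<close> are \<open>Re (\<chi> n)\<close> times the indicator that \<open>n\<close> is a pseudo-prime. Centering
  them costs only \<open>O(1)\<close>, because \<open>\<Sum> Re (\<chi> n) / ln n\<close> has bounded partial sums (Dirichlet's test).
  At a deterministic index \<open>a\<close> with \<open>\<Sum>n<a. 1 / ln n \<approx> N - N powr (3/4)\<close> the centered sum is asymptotically
  normal with variance \<open>\<approx> s\<^sup>2 N\<close>. With high probability the random index \<open>p'\<^sub>N\<close> lies between \<open>a\<close> and
  the analogous \<open>b\<close> for \<open>N + N powr (3/4)\<close>. The event \<open>n \<le> p'\<^sub>N\<close> is decided by the variables before \<open>n\<close>,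
  so the contribution of \<open>a \<le> n \<le> p'\<^sub>N\<close> is a sum of orthogonal terms with second moment \<open>O(N powr (3/4))\<close>,
  which is negligible. The factor \<open>1 + ln (ln N) / ln N\<close> tends to 1.\<close>

section \<open>Character sums and weights\<close>

text \<open>Whole periods cancel. The strong induction strips one period from the front, until at
  most \<open>k\<close> terms are left.\<close>

lemma abs_sum_periodic_le:
  fixes g :: "nat \<Rightarrow> real"
  assumes k: "k > 0" and per: "\<And>n. g (n + k) = g n" and zero: "(\<Sum>n<k. g n) = 0"
  shows "\<bar>\<Sum>n<m. g n\<bar> \<le> (\<Sum>n<k. \<bar>g n\<bar>)"
proof (induction m rule: less_induct)
  case (less m)
  show ?case
  proof (cases "m \<le> k")
    case True
    have "\<bar>\<Sum>n<m. g n\<bar> \<le> (\<Sum>n<m. \<bar>g n\<bar>)" by (rule sum_abs)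
    also have "\<dots> \<le> (\<Sum>n<k. \<bar>g n\<bar>)" using True by (intro sum_mono2) auto
    finally show ?thesis .
  next
    case False
    have "{..<m} = {..<k} \<union> {k..<m}" using False by auto
    then have "(\<Sum>n<m. g n) = (\<Sum>n<k. g n) + (\<Sum>n=k..<m. g n)"
      by (simp add: sum.union_disjoint ivl_disj_int)
    also have "(\<Sum>n=k..<m. g n) = (\<Sum>n<m-k. g (n + k))"
      using False by (intro sum.reindex_bij_witness[of _ "\<lambda>n. n + k" "\<lambda>n. n - k"]) auto
    finally show ?thesis using less[of "m - k"] False k by (simp add: zero per)
  qed
qed

text \<open>Dirichlet's test: the partial sums of \<open>g\<close> are bounded and the decrements of
  \<open>p\<close> telescope. The bound is uniform in \<open>m\<close>, so it may later be used at a
  random endpoint.\<close>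

lemma sum_periodic_antimono_bounded:
  fixes g p :: "nat \<Rightarrow> real"
  assumes k: "k > 0" and per: "\<And>n. g (n + k) = g n" and zero: "(\<Sum>n<k. g n) = 0"
    and p: "\<And>n. n \<ge> a \<Longrightarrow> 0 \<le> p n" "\<And>n. n \<ge> a \<Longrightarrow> p (Suc n) \<le> p n"
  obtains K where "\<And>m. \<bar>\<Sum>n=a..<m. g n * p n\<bar> \<le> K"
proof -
  \<comment> \<open>The factor 2 appears because a sum starting at \<open>a\<close> is a difference
    of two initial sums, each bounded by the sum of \<bar>g\<bar> over one period.\<close>
  define C where "C = 2 * (\<Sum>n<k. \<bar>g n\<bar>)"
  define G where "G m = (\<Sum>n=a..<m. g n)" for m
  have C: "C \<ge> 0" by (auto simp: C_def sum_nonneg)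
  have G: "\<bar>G m\<bar> \<le> C" if "m \<ge> a" for m
  proof -
    have "{..<m} = {..<a} \<union> {a..<m}" using that by auto
    then have "(\<Sum>n<m. g n) = (\<Sum>n<a. g n) + G m"
      by (simp add: sum.union_disjoint ivl_disj_int G_def)
    then show ?thesis
      using abs_sum_periodic_le[of k g m, OF k per zero] abs_sum_periodic_le[of k g a, OF k per zero]
      by (simp add: C_def)
  qed
  \<comment> \<open>Abel summation carried out by induction: relative to the boundary term
    \<open>G m * p m\<close>, each step adds one product of a bounded \<open>G\<close> with a
    decrement of \<open>p\<close>.\<close>
  have main: "\<bar>(\<Sum>n=a..<m. g n * p n) - G m * p m\<bar> \<le> C * (p a - p m)" if "m \<ge> a" for m
    using that
  proof (induction m rule: dec_induct)
    case base
    show ?case by (simp add: G_def)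
  next
    case (step m)
    have "\<bar>G (Suc m) * (p m - p (Suc m))\<bar> \<le> C * (p m - p (Suc m))"
      using G[of "Suc m"] p(2)[of m] step by (auto simp: abs_mult intro!: mult_right_mono)
    moreover have "(\<Sum>n=a..<Suc m. g n * p n) - G (Suc m) * p (Suc m)
        = ((\<Sum>n=a..<m. g n * p n) - G m * p m) + G (Suc m) * (p m - p (Suc m))"
      using step by (simp add: G_def algebra_simps)
    ultimately show ?case using step.IH by (simp add: algebra_simps)
  qed
  have "\<bar>\<Sum>n=a..<m. g n * p n\<bar> \<le> C * p a" for m
  proof (cases "m \<ge> a")
    case True
    have "\<bar>G m * p m\<bar> \<le> C * p m"
      using G[OF True] p(1)[OF True] by (auto simp: abs_mult intro!: mult_right_mono)
    with main[OF True] show ?thesis by (simp add: algebra_simps)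
  qed (use C p(1)[of a] in auto)
  then show ?thesis by (rule that)
qed

section \<open>Orthogonality and second moments of character values\<close>

text \<open>Multiplication by the unit \<open>u\<close> permutes the residues, so the sum equals
  \<open>f u\<close> times itself. It serves both for \<chi> and for its square.\<close>

lemma sum_multiplicative_periodic_eq_0:
  fixes f :: "nat \<Rightarrow> 'a::idom"
  assumes k: "k > 0" and mult: "\<And>m n. f (m * n) = f m * f n" and per: "\<And>n. f (n + k) = f n"
    and u: "coprime u k" "f u \<noteq> 1"
  shows "(\<Sum>n<k. f n) = 0"
proof -
  have per': "f (n + m * k) = f n" for n m
  proof (induction m)
    case (Suc m)
    then show ?case using per[of "n + m * k"] by (simp add: algebra_simps)
  qed simp
  have fmod: "f (n mod k) = f n" for n
    using per'[of "n mod k" "n div k"] by (simp add: mult.commute)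
  have inj: "inj_on (\<lambda>n. u * n mod k) {..<k}"
  proof (rule inj_onI)
    fix x y assume xy: "x \<in> {..<k}" "y \<in> {..<k}" "u * x mod k = u * y mod k"
    then have "[u * x = u * y] (mod k)" by (simp add: cong_def)
    then have "[x = y] (mod k)" using u(1) by (simp add: cong_mult_lcancel_nat)
    then show "x = y" using xy by (simp add: cong_def)
  qed
  have "(\<lambda>n. u * n mod k) ` {..<k} = {..<k}"
    by (rule endo_inj_surj) (use inj k in auto)
  with inj have bij: "bij_betw (\<lambda>n. u * n mod k) {..<k} {..<k}" by (simp add: bij_betw_def)
  have "(\<Sum>n<k. f n) = (\<Sum>n<k. f (u * n mod k))"
    using sum.reindex_bij_betw[OF bij, of f] by simp
  also have "\<dots> = f u * (\<Sum>n<k. f n)"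
    by (simp add: fmod mult sum_distrib_left)
  finally have "(f u - 1) * (\<Sum>n<k. f n) = 0" by (simp add: algebra_simps)
  with u(2) show ?thesis by simp
qed

text \<open>The totatives lie in the range from 1 to \<open>k\<close>. Exchanging \<open>k\<close>
  for 0 changes nothing unless \<open>k = 1\<close>, since neither is otherwise coprime to
  \<open>k\<close>.\<close>

lemma card_coprime_lessThan_eq_totient:
  assumes "k > 0"
  shows "card {n\<in>{..<k}. coprime n k} = totient k"
proof (cases "k = 1")
  case True
  then show ?thesis by (simp add: Collect_conv_if card_1_singleton_iff)
next
  case False
  have "{n\<in>{..<k}. coprime n k} = totatives k"
    using False assms by (auto simp: totatives_def le_less intro!: Nat.gr0I)
  then show ?thesis by (simp add: totient_def)
qed

text \<open>The second claim rests on (Re z)^2 = (\<bar>z\<bar>^2 + Re (z^2)) / 2. For a real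
  character both terms agree; otherwise the squares sum to 0 over a period. This is the origin of
  the factor 1 or 1/2 in the variance.\<close>

lemma
  assumes chi: "dirichlet_character k chi" and np: "chi \<noteq> principal_character k"
    and unit: "\<And>n. chi n \<noteq> 0 \<Longrightarrow> cmod (chi n) = 1"
  shows sum_Re_dirichlet_character: "(\<Sum>n<k. Re (chi n)) = 0"
    and sum_Re_power2_dirichlet_character:
      "(\<Sum>n<k. (Re (chi n))\<^sup>2) = real k * character_variance k chi"
proof -
  from chi have k: "k > 0" and mult: "\<And>m n. chi (m * n) = chi m * chi n"
    and per: "\<And>n. chi (n + k) = chi n" and nz: "\<And>n. chi n \<noteq> 0 \<longleftrightarrow> coprime n k"
    by (auto simp: dirichlet_character_def)
  have nz': "chi n = 0 \<longleftrightarrow> \<not> coprime n k" for n using nz by blast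
  \<comment> \<open>Off the units both characters vanish, so they must differ at a unit, where the
    principal one is 1.\<close>
  obtain u where u: "coprime u k" "chi u \<noteq> 1"
  proof -
    obtain x where x: "chi x \<noteq> principal_character k x" using np by blast
    then show ?thesis using nz'[of x] by (intro that[of x]) (auto simp: principal_character_def split: if_splits)
  qed
  have "(\<Sum>n<k. chi n) = 0" by (rule sum_multiplicative_periodic_eq_0[OF k mult per u])
  then show "(\<Sum>n<k. Re (chi n)) = 0" by (metis Re_sum zero_complex.simps(1))
  have tot: "(\<Sum>n<k. (cmod (chi n))\<^sup>2) = real (totient k)"
  proof -
    have "(\<Sum>n<k. (cmod (chi n))\<^sup>2) = (\<Sum>n<k. if coprime n k then 1 else 0)"
      using unit nz by (intro sum.cong) auto
    also have "\<dots> = real (card {n\<in>{..<k}. coprime n k})"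
      by (simp flip: sum.inter_filter)
    finally show ?thesis using card_coprime_lessThan_eq_totient[OF k] by simp
  qed
  show "(\<Sum>n<k. (Re (chi n))\<^sup>2) = real k * character_variance k chi"
  proof (cases "\<forall>n. chi n \<in> \<real>")
    case True
    then have "(\<Sum>n<k. (Re (chi n))\<^sup>2) = (\<Sum>n<k. (cmod (chi n))\<^sup>2)"
      by (intro sum.cong) (auto simp: cmod_power2 complex_is_Real_iff)
    then show ?thesis using True k tot by (simp add: character_variance_def)
  next
    case False
    then obtain v where v: "chi v \<notin> \<real>" by blast
    then have "coprime v k" using nz[of v] by fastforce
    \<comment> \<open>The square roots of 1 are real, so the square of \<chi> is not 1 at the unit
      \<open>v\<close> and its sum over a period vanishes too.\<close>
    moreover have "(chi v)\<^sup>2 \<noteq> 1" using v by (auto simp: power2_eq_1_iff)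
    ultimately have "(\<Sum>n<k. (chi n)\<^sup>2) = 0"
      by (intro sum_multiplicative_periodic_eq_0[OF k]) (auto simp: mult per power_mult_distrib)
    then have "(\<Sum>n<k. Re ((chi n)\<^sup>2)) = 0" by (metis Re_sum zero_complex.simps(1))
    moreover have "(\<Sum>n<k. (Re (chi n))\<^sup>2) = (\<Sum>n<k. ((cmod (chi n))\<^sup>2 + Re ((chi n)\<^sup>2)) / 2)"
      by (simp add: cmod_power2 Re_power2)
    ultimately have "(\<Sum>n<k. (Re (chi n))\<^sup>2) = real (totient k) / 2"
      by (simp add: tot sum.distrib flip: sum_divide_distrib)
    then show ?thesis using k unfolding character_variance_def if_not_P[OF False] by simp
  qed
qed

section \<open>The weights 1 / ln n and their partial sums\<close>

text \<open>The expected number of pseudo-primes below \<open>m\<close>, a discrete logarithmic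
  integral.\<close>

definition li_sum :: "nat \<Rightarrow> real" where
  "li_sum m = (\<Sum>n=3..<m. 1 / ln (real n))"

lemma ln_ge_1: "1 \<le> ln (real n)" if "n \<ge> 3"
proof -
  have "exp 1 \<le> real n" using exp_le that by linarith
  then show ?thesis using that by (simp add: ln_ge_iff)
qed

lemma inverse_ln_bounds: "0 < 1 / ln (real n)" "1 / ln (real n) \<le> 1" if "n \<ge> 3"
  using ln_ge_1[OF that] by (auto simp: divide_simps)

lemma inverse_ln_antimono: "1 / ln (real n) \<le> 1 / ln (real m)" if "3 \<le> m" "m \<le> n"
  using ln_ge_1[of m] that by (intro divide_left_mono) auto

lemma li_sum_diff: "li_sum b - li_sum a = (\<Sum>n=a..<b. 1 / ln (real n))" if "3 \<le> a" "a \<le> b"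
proof -
  have "{3..<b} = {3..<a} \<union> {a..<b}" using that by auto
  then show ?thesis by (simp add: li_sum_def sum.union_disjoint ivl_disj_int)
qed

lemma filterlim_li_sum: "filterlim li_sum at_top at_top"
proof (rule filterlim_at_top_mono)
  show "filterlim (\<lambda>m. (real m - 3) / ln (real m)) at_top at_top" by real_asymp
  show "\<forall>\<^sub>F m in at_top. (real m - 3) / ln (real m) \<le> li_sum m"
    using eventually_ge_at_top[of 3]
  proof eventually_elim
    case (elim m)
    have "(\<Sum>n=3..<m. 1 / ln (real m)) \<le> li_sum m"
      unfolding li_sum_def by (intro sum_mono inverse_ln_antimono) auto
    then show ?case using elim by (simp add: of_nat_diff)
  qed
qed

text \<open>Each increment is at most 1, so the first index at which \<open>li_sum\<close> reaches
  \<open>x\<close> overshoots by at most 1.\<close>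

lemma li_sum_inverse:
  assumes "x \<ge> 0"
  obtains m where "m \<ge> 3" "x \<le> li_sum m" "li_sum m \<le> x + 1"
proof -
  have "\<exists>m. x \<le> li_sum m"
    using filterlim_li_sum eventually_happens[of "\<lambda>m. x \<le> li_sum m" at_top]
    by (auto simp: filterlim_at_top)
  define m where "m = (LEAST m. x \<le> li_sum m)"
  have m: "x \<le> li_sum m" using \<open>\<exists>m. x \<le> li_sum m\<close> unfolding m_def by (rule LeastI_ex)
  show ?thesis
  proof (cases "m > 3")
    case True
    have "m - 1 < (LEAST m. x \<le> li_sum m)" using True unfolding m_def[symmetric] by simp
    from not_less_Least[OF this] have "li_sum (m - 1) < x" by simp
    moreover have "li_sum m = li_sum (m - 1) + 1 / ln (real (m - 1))"
      using li_sum_diff[of "m - 1" m] True by (cases m) auto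
    moreover have "1 / ln (real (m - 1)) \<le> 1" using True by (intro inverse_ln_bounds) simp
    ultimately show ?thesis using m True by (intro that[of m]) linarith+
  next
    \<comment> \<open>Here the sum is empty, which forces \<open>x = 0\<close>, and the index 3
      serves.\<close>
    case False
    then have "li_sum m = 0" "li_sum 3 = 0" by (auto simp: li_sum_def)
    then show ?thesis using m assms by (intro that[of 3]) auto
  qed
qed

text \<open>The weights \<open>1 / ln n\<close> tend to 0 but are not summable, so their squares are negligible.\<close>

lemma weighted_variance_asymp:
  fixes g :: "nat \<Rightarrow> real"
  assumes k: "k > 0" and per: "\<And>n. g (n + k) = g n" and mean: "(\<Sum>n<k. g n) = real k * s"
    and g: "\<And>n. 0 \<le> g n" "\<And>n. g n \<le> 1"
  shows "(\<lambda>m. (\<Sum>n=3..<m. g n * (1 / ln (real n) - (1 / ln (real n))\<^sup>2)) / li_sum m) \<longlonglongrightarrow> s"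
proof -
  define p where "p n = 1 / ln (real n)" for n
  \<comment> \<open>Replacing \<open>g\<close> by its mean \<open>s\<close> costs only O(1), by
    Dirichlet's test for the mean-zero function \<open>g - s\<close>; dividing by
    \<open>li_sum\<close> removes this error.\<close>
  obtain K where K: "\<And>m. \<bar>\<Sum>n=3..<m. (g n - s) * p n\<bar> \<le> K"
  proof (rule sum_periodic_antimono_bounded[of k "\<lambda>n. g n - s" 3 p, OF k])
    show "(\<Sum>n<k. g n - s) = 0" by (simp add: sum_subtractf mean)
    show "p (Suc n) \<le> p n" if "n \<ge> 3" for n
      unfolding p_def using that by (intro inverse_ln_antimono) auto
  qed (use per inverse_ln_bounds in \<open>auto simp: p_def less_imp_le\<close>)
  have 1: "(\<lambda>m. (\<Sum>n=3..<m. (g n - s) * p n) / li_sum m) \<longlonglongrightarrow> 0"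
  proof (rule Lim_null_comparison)
    show "\<forall>\<^sub>F m in at_top. norm ((\<Sum>n=3..<m. (g n - s) * p n) / li_sum m) \<le> K / li_sum m"
      using filterlim_at_top_dense[THEN iffD1, OF filterlim_li_sum, rule_format, of 0]
      by eventually_elim (use K in \<open>auto intro!: divide_right_mono\<close>)
    show "(\<lambda>m. K / li_sum m) \<longlonglongrightarrow> 0"
      by (rule tendsto_divide_0[OF tendsto_const filterlim_at_top_imp_at_infinity[OF filterlim_li_sum]])
  qed
  have p0: "p \<longlonglongrightarrow> 0" unfolding p_def by real_asymp
  have 2: "(\<lambda>m. (\<Sum>n=3..<m. g n * (p n)\<^sup>2) / li_sum m) \<longlonglongrightarrow> 0"
  proof (rule tendstoI)
    fix e :: real assume e: "e > 0"
    obtain n0 where n0: "\<And>n. n \<ge> n0 \<Longrightarrow> \<bar>p n\<bar> < e / 2"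
      using LIMSEQ_D[OF p0, of "e / 2"] e by auto
    \<comment> \<open>Indices below \<open>n0\<close> contribute at most 1 each; beyond
      \<open>n0\<close> one factor \<open>p n\<close> of the square is below
      \<open>e / 2\<close>.\<close>
    have bd: "(\<Sum>n=3..<m. g n * (p n)\<^sup>2) \<le> real n0 + e / 2 * li_sum m" for m
    proof -
      have "(\<Sum>n=3..<m. g n * (p n)\<^sup>2) \<le> (\<Sum>n=3..<m. (if n < n0 then 1 else 0) + e / 2 * p n)"
      proof (rule sum_mono)
        fix n assume n: "n \<in> {3..<m}"
        then have pn: "0 < p n" "p n \<le> 1" using inverse_ln_bounds[of n] by (auto simp: p_def)
        have "g n * (p n)\<^sup>2 \<le> 1 * (p n)\<^sup>2" using g[of n] by (intro mult_right_mono) auto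
        moreover have "(p n)\<^sup>2 \<le> 1" using pn by (simp add: power_le_one)
        moreover have "(p n)\<^sup>2 \<le> e / 2 * p n" if "n \<ge> n0"
          using n0[OF that] pn unfolding power2_eq_square by (intro mult_right_mono) auto
        moreover have "0 \<le> e / 2 * p n" using pn e by simp
        ultimately show "g n * (p n)\<^sup>2 \<le> (if n < n0 then 1 else 0) + e / 2 * p n"
          by (cases "n < n0") auto
      qed
      also have "\<dots> = real (card {n\<in>{3..<m}. n < n0}) + e / 2 * li_sum m"
        by (simp add: sum.distrib li_sum_def p_def sum_distrib_left flip: sum.inter_filter)
      also have "card {n\<in>{3..<m}. n < n0} \<le> card {..<n0}" by (intro card_mono) auto
      finally show ?thesis by simp
    qed
    have nn: "0 \<le> (\<Sum>n=3..<m. g n * (p n)\<^sup>2)" for m using g by (auto intro!: sum_nonneg)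
    have "\<forall>\<^sub>F m in at_top. li_sum m > 2 * real n0 / e"
      using filterlim_li_sum by (simp add: filterlim_at_top_dense)
    then show "\<forall>\<^sub>F m in sequentially. dist ((\<Sum>n=3..<m. g n * (p n)\<^sup>2) / li_sum m) 0 < e"
    proof eventually_elim
      case (elim m)
      have "0 \<le> 2 * real n0 / e" using e by simp
      with elim have pos: "li_sum m > 0" by linarith
      from elim e have "real n0 < e / 2 * li_sum m" by (simp add: field_simps)
      with bd[of m] have "(\<Sum>n=3..<m. g n * (p n)\<^sup>2) < e * li_sum m" by simp
      then show ?case using nn[of m] pos by (simp add: divide_simps)
    qed
  qed
  have "(\<lambda>m. s + (\<Sum>n=3..<m. (g n - s) * p n) / li_sum m - (\<Sum>n=3..<m. g n * (p n)\<^sup>2) / li_sum m)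
      \<longlonglongrightarrow> s + 0 - 0"
    by (intro tendsto_intros 1 2)
  moreover have "\<forall>\<^sub>F m in at_top. s + (\<Sum>n=3..<m. (g n - s) * p n) / li_sum m
      - (\<Sum>n=3..<m. g n * (p n)\<^sup>2) / li_sum m = (\<Sum>n=3..<m. g n * (p n - (p n)\<^sup>2)) / li_sum m"
    using filterlim_at_top_dense[THEN iffD1, OF filterlim_li_sum, rule_format, of 0]
  proof eventually_elim
    case (elim m)
    have "(\<Sum>n=3..<m. (g n - s) * p n) = (\<Sum>n=3..<m. g n * p n) - s * li_sum m"
      by (simp add: left_diff_distrib diff_divide_distrib sum_subtractf li_sum_def p_def sum_distrib_left)
    then show ?case using elim
      by (simp add: right_diff_distrib sum_subtractf diff_divide_distrib)
  qed
  ultimately show ?thesis unfolding p_def by (simp add: tendsto_cong)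
qed

section \<open>From the position of an element to a counting function\<close>

text \<open>The element with index \<open>n\<close>, counted from 0, has exactly \<open>n\<close>
  elements below it. The assumption provides more than \<open>n\<close> elements, so that
  \<open>enumerate\<close> is meaningful even for finite \<open>S\<close>. The induction removes the
  least element.\<close>

lemma le_enumerate_iff:
  fixes S :: "nat set"
  assumes "n < card (S \<inter> {..<b})"
  shows "j \<le> enumerate S n \<longleftrightarrow> card (S \<inter> {..<j}) \<le> n"
  using assms
proof (induction n arbitrary: S)
  case 0
  then have "\<exists>x. x \<in> S" by (metis Int_emptyI card.empty less_irrefl)
  then have L: "(LEAST x. x \<in> S) \<in> S" by (auto intro: LeastI)
  then have "j \<le> (LEAST x. x \<in> S) \<longleftrightarrow> S \<inter> {..<j} = {}"
    by (auto simp: disjoint_iff dest: not_less_Least) (metis Least_le linorder_not_le order_less_le_trans)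
  moreover have "enumerate S 0 = (LEAST x. x \<in> S)" by (rule enumerate_0)
  ultimately show ?case by simp
next
  case (Suc n)
  define l where "l = (LEAST x. x \<in> S)"
  have "S \<inter> {..<b} \<noteq> {}" using Suc.prems by force
  then have lS: "l \<in> S" unfolding l_def by (auto intro: LeastI)
  have lmin: "l \<le> x" if "x \<in> S" for x using that unfolding l_def by (rule Least_le)
  have cd: "card ((S - {l}) \<inter> {..<j}) = card (S \<inter> {..<j}) - 1" for j
  proof (cases "l < j")
    case True
    have "(S - {l}) \<inter> {..<j} = (S \<inter> {..<j}) - {l}" by auto
    then show ?thesis using lS True by simp
  next
    case False
    then have "S \<inter> {..<j} = {}" using lmin by fastforce
    then show ?thesis by (metis Diff_Int_distrib2 card.empty diff_0_eq_0 empty_Diff)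
  qed
  have "j \<le> enumerate (S - {l}) n \<longleftrightarrow> card ((S - {l}) \<inter> {..<j}) \<le> n"
    using Suc.prems cd[of b] by (intro Suc.IH) simp
  moreover have "enumerate S (Suc n) = enumerate (S - {l}) n" by (simp add: enumerate_Suc l_def)
  ultimately show ?case by (simp add: cd) linarith
qed

section \<open>Limit theorems for independent variables\<close>

lemma abs_exp_minus_linear_le:
  fixes x :: real
  assumes "x \<ge> 0"
  shows "\<bar>exp (- x) - (1 - x)\<bar> \<le> x\<^sup>2"
proof -
  have "exp (- x) = 1 / exp x" by (simp add: exp_minus inverse_eq_divide)
  also have "\<dots> \<le> 1 / (1 + x)" using assms exp_ge_add_one_self[of x] by (intro divide_left_mono) auto
  also have "\<dots> \<le> 1 - x + x\<^sup>2"
  proof -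
    have "(1 - x + x\<^sup>2) * (1 + x) = 1 + x ^ 3" by (simp add: algebra_simps power2_eq_square power3_eq_cube)
    then show ?thesis using assms by (simp add: divide_le_eq)
  qed
  finally show ?thesis using exp_ge_add_one_self[of "- x"] by simp
qed

context prob_space
begin

text \<open>One factor of the third moment is traded for the bound \<open>w\<close>, which turns the
  error term of the quadratic approximation of a characteristic function into a small multiple of
  the variance.\<close>

lemma expectation_min_moment_le:
  assumes rv[measurable]: "random_variable borel X"
    and bd: "\<And>\<omega>. \<omega> \<in> space M \<Longrightarrow> \<bar>X \<omega>\<bar> \<le> (w::real)"
  shows "expectation (\<lambda>\<omega>. min (6 * (X \<omega>)\<^sup>2) (\<bar>t\<bar> * \<bar>X \<omega>\<bar> ^ 3)) \<le> \<bar>t\<bar> * w * expectation (\<lambda>\<omega>. (X \<omega>)\<^sup>2)"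
proof -
  have sq: "(X \<omega>)\<^sup>2 \<le> w\<^sup>2" if "\<omega> \<in> space M" for \<omega>
    using bd[OF that] by (metis abs_ge_zero power2_abs power_mono)
  have int: "integrable M (\<lambda>\<omega>. (X \<omega>)\<^sup>2)"
    by (rule integrable_const_bound[of _ "w\<^sup>2"]) (auto simp: sq)
  have "expectation (\<lambda>\<omega>. min (6 * (X \<omega>)\<^sup>2) (\<bar>t\<bar> * \<bar>X \<omega>\<bar> ^ 3)) \<le> expectation (\<lambda>\<omega>. \<bar>t\<bar> * w * (X \<omega>)\<^sup>2)"
  proof (rule integral_mono)
    show "integrable M (\<lambda>\<omega>. min (6 * (X \<omega>)\<^sup>2) (\<bar>t\<bar> * \<bar>X \<omega>\<bar> ^ 3))"
      by (rule Bochner_Integration.integrable_bound[OF integrable_mult_right[OF int, of 6]]) auto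
    show "integrable M (\<lambda>\<omega>. \<bar>t\<bar> * w * (X \<omega>)\<^sup>2)" using int by simp
    fix \<omega> assume "\<omega> \<in> space M"
    have "\<bar>t\<bar> * \<bar>X \<omega>\<bar> ^ 3 = \<bar>t\<bar> * (\<bar>X \<omega>\<bar> * (X \<omega>)\<^sup>2)" by (simp add: power3_eq_cube power2_eq_square)
    also have "\<dots> \<le> \<bar>t\<bar> * (w * (X \<omega>)\<^sup>2)"
      using bd[OF \<open>\<omega> \<in> space M\<close>] by (intro mult_left_mono mult_right_mono) auto
    finally show "min (6 * (X \<omega>)\<^sup>2) (\<bar>t\<bar> * \<bar>X \<omega>\<bar> ^ 3) \<le> \<bar>t\<bar> * w * (X \<omega>)\<^sup>2" by simp
  qed
  then show ?thesis by simp
qed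

text \<open>A central limit theorem for triangular arrays whose terms are bounded by
  \<open>w N\<close>, tending to 0. Each factor of the characteristic function differs from a
  Gaussian factor by o(1) times its variance, and the variances add up to a bounded total.\<close>

lemma char_sum_tendsto_std_normal:
  fixes X :: "nat \<Rightarrow> 'i \<Rightarrow> 'a \<Rightarrow> real"
  assumes fin: "\<And>N. finite (J N)"
    and indep: "\<And>N. indep_vars (\<lambda>_. borel) (X N) (J N)"
    and mean: "\<And>N j. j \<in> J N \<Longrightarrow> expectation (X N j) = 0"
    and bd: "\<And>N j \<omega>. j \<in> J N \<Longrightarrow> \<omega> \<in> space M \<Longrightarrow> \<bar>X N j \<omega>\<bar> \<le> w N"
    and w: "\<And>N. 0 \<le> w N" "w \<longlonglongrightarrow> 0"
    and var: "(\<lambda>N. \<Sum>j\<in>J N. expectation (\<lambda>\<omega>. (X N j \<omega>)\<^sup>2)) \<longlonglongrightarrow> 1"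
  shows "(\<lambda>N. char (distr M borel (\<lambda>\<omega>. \<Sum>j\<in>J N. X N j \<omega>)) t) \<longlonglongrightarrow> char std_normal_distribution t"
proof -
  define v where "v N j = expectation (\<lambda>\<omega>. (X N j \<omega>)\<^sup>2)" for N j
  define V where "V N = (\<Sum>j\<in>J N. v N j)" for N
  have rv[measurable]: "random_variable borel (X N j)" if "j \<in> J N" for N j
    using indep[of N] that by (simp add: indep_vars_def2)
  have sq: "(X N j \<omega>)\<^sup>2 \<le> (w N)\<^sup>2" if "j \<in> J N" "\<omega> \<in> space M" for N j \<omega>
    using bd[OF that] by (metis abs_ge_zero power2_abs power_mono)
  have int: "integrable M (X N j)" if "j \<in> J N" for N j
    by (rule integrable_const_bound[of _ "w N"]) (use bd rv that in auto)
  have int2: "integrable M (\<lambda>\<omega>. (X N j \<omega>)\<^sup>2)" if "j \<in> J N" for N j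
    by (rule integrable_const_bound[of _ "(w N)\<^sup>2"]) (use sq rv that in auto)
  have v0: "0 \<le> v N j" for N j by (simp add: v_def)
  have v1: "v N j \<le> (w N)\<^sup>2" if "j \<in> J N" for N j
  proof -
    have "v N j \<le> expectation (\<lambda>_. (w N)\<^sup>2)"
      unfolding v_def by (rule integral_mono) (use int2 sq that in auto)
    then show ?thesis by (simp add: prob_space)
  qed
  \<comment> \<open>Both sides are compared with 1 - t^2 v / 2. On the Gaussian side the error is
    quadratic in the variance, and one of the two variances is bounded by the square of
    \<open>w N\<close>.\<close>
  have step: "cmod (char (distr M borel (X N j)) t - complex_of_real (exp (- (t\<^sup>2 * v N j / 2))))
      \<le> (\<bar>t\<bar> ^ 3 * w N / 6 + t ^ 4 * (w N)\<^sup>2 / 4) * v N j" if j: "j \<in> J N" for N j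
  proof -
    have "cmod (char (distr M borel (X N j)) t - (1 - t\<^sup>2 * v N j / 2))
        \<le> t\<^sup>2 / 6 * expectation (\<lambda>\<omega>. min (6 * (X N j \<omega>)\<^sup>2) (\<bar>t\<bar> * \<bar>X N j \<omega>\<bar> ^ 3))"
      by (rule char_approx3') (use j rv int int2 mean in \<open>auto simp: v_def\<close>)
    also have "\<dots> \<le> t\<^sup>2 / 6 * (\<bar>t\<bar> * w N * v N j)"
      unfolding v_def by (intro mult_left_mono expectation_min_moment_le) (use j rv bd in auto)
    also have "\<dots> = \<bar>t\<bar> ^ 3 * w N / 6 * v N j" by (simp add: power2_eq_square power3_eq_cube)
    finally have a: "cmod (char (distr M borel (X N j)) t - (1 - t\<^sup>2 * v N j / 2)) \<le> \<dots>" .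
    have "cmod (complex_of_real (exp (- (t\<^sup>2 * v N j / 2))) - (1 - t\<^sup>2 * v N j / 2))
        = cmod (complex_of_real (exp (- (t\<^sup>2 * v N j / 2)) - (1 - t\<^sup>2 * v N j / 2)))" by simp
    also have "\<dots> = \<bar>exp (- (t\<^sup>2 * v N j / 2)) - (1 - t\<^sup>2 * v N j / 2)\<bar>" by (rule norm_of_real)
    also have "\<dots> \<le> (t\<^sup>2 * v N j / 2)\<^sup>2" using v0 by (intro abs_exp_minus_linear_le) auto
    also have "\<dots> = t ^ 4 / 4 * v N j * v N j" by (simp add: power2_eq_square power4_eq_xxxx)
    also have "\<dots> \<le> t ^ 4 / 4 * v N j * (w N)\<^sup>2" using v0 v1[OF j] by (intro mult_left_mono) auto
    finally have "cmod (complex_of_real (exp (- (t\<^sup>2 * v N j / 2))) - (1 - t\<^sup>2 * v N j / 2))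
      \<le> t ^ 4 * (w N)\<^sup>2 / 4 * v N j" by (simp add: mult_ac)
    with a show ?thesis using norm_triangle_ineq4[of
        "char (distr M borel (X N j)) t - (1 - t\<^sup>2 * v N j / 2)"
        "complex_of_real (exp (- (t\<^sup>2 * v N j / 2))) - (1 - t\<^sup>2 * v N j / 2)"]
      by (simp add: algebra_simps)
  qed
  have prod: "cmod (char (distr M borel (\<lambda>\<omega>. \<Sum>j\<in>J N. X N j \<omega>)) t - complex_of_real (exp (- (t\<^sup>2 / 2 * V N))))
      \<le> (\<bar>t\<bar> ^ 3 * w N / 6 + t ^ 4 * (w N)\<^sup>2 / 4) * V N" for N
  proof -
    have "exp (- (t\<^sup>2 / 2 * V N)) = (\<Prod>j\<in>J N. exp (- (t\<^sup>2 * v N j / 2)))"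
      by (simp add: V_def fin sum_distrib_left sum_negf flip: exp_sum)
    then have "cmod (char (distr M borel (\<lambda>\<omega>. \<Sum>j\<in>J N. X N j \<omega>)) t - complex_of_real (exp (- (t\<^sup>2 / 2 * V N))))
      = cmod ((\<Prod>j\<in>J N. char (distr M borel (X N j)) t) - (\<Prod>j\<in>J N. complex_of_real (exp (- (t\<^sup>2 * v N j / 2)))))"
      by (simp add: char_distr_sum[OF indep])
    also have "\<dots> \<le> (\<Sum>j\<in>J N. cmod (char (distr M borel (X N j)) t - complex_of_real (exp (- (t\<^sup>2 * v N j / 2)))))"
    \<comment> \<open>For factors of modulus at most 1, the distance of the products is at most the
      sum of the distances.\<close>
    proof (rule norm_prod_diff)
      fix j assume j: "j \<in> J N"
      interpret D: real_distribution "distr M borel (X N j)" using rv[OF j] by simp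
      show "cmod (char (distr M borel (X N j)) t) \<le> 1" by (rule D.cmod_char_le_1)
      show "cmod (complex_of_real (exp (- (t\<^sup>2 * v N j / 2)))) \<le> 1"
        using v0[of N j] by (simp del: of_real_exp)
    qed
    also have "\<dots> \<le> (\<Sum>j\<in>J N. (\<bar>t\<bar> ^ 3 * w N / 6 + t ^ 4 * (w N)\<^sup>2 / 4) * v N j)"
      by (intro sum_mono step)
    finally show ?thesis by (simp add: V_def sum_distrib_left)
  qed
  have V: "V \<longlonglongrightarrow> 1" using var by (simp add: V_def[abs_def] v_def)
  have diff: "(\<lambda>N. char (distr M borel (\<lambda>\<omega>. \<Sum>j\<in>J N. X N j \<omega>)) t - complex_of_real (exp (- (t\<^sup>2 / 2 * V N)))) \<longlonglongrightarrow> 0"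
  proof (rule Lim_null_comparison[OF always_eventually])
    show "\<forall>N. norm (char (distr M borel (\<lambda>\<omega>. \<Sum>j\<in>J N. X N j \<omega>)) t - complex_of_real (exp (- (t\<^sup>2 / 2 * V N))))
      \<le> (\<bar>t\<bar> ^ 3 * w N / 6 + t ^ 4 * (w N)\<^sup>2 / 4) * V N" using prod by blast
    have "(\<lambda>N. (\<bar>t\<bar> ^ 3 * w N / 6 + t ^ 4 * (w N)\<^sup>2 / 4) * V N) \<longlonglongrightarrow> (\<bar>t\<bar> ^ 3 * 0 / 6 + t ^ 4 * 0\<^sup>2 / 4) * 1"
      by (intro tendsto_intros w V) simp_all
    then show "(\<lambda>N. (\<bar>t\<bar> ^ 3 * w N / 6 + t ^ 4 * (w N)\<^sup>2 / 4) * V N) \<longlonglongrightarrow> 0" by simp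
  qed
  have "(\<lambda>N. complex_of_real (exp (- (t\<^sup>2 / 2 * V N)))) \<longlonglongrightarrow> complex_of_real (exp (- (t\<^sup>2 / 2 * 1)))"
    by (intro tendsto_intros V)
  then have "(\<lambda>N. char (distr M borel (\<lambda>\<omega>. \<Sum>j\<in>J N. X N j \<omega>)) t) \<longlonglongrightarrow> complex_of_real (exp (- (t\<^sup>2 / 2 * 1)))"
    using diff by (rule Lim_transform)
  then show ?thesis by (simp add: char_std_normal_distribution)
qed

text \<open>Off the exceptional event the integrands differ by at most
  \<open>\<bar>t\<bar> * e\<close>, because x \<mapsto> exp (i t x) is Lipschitz with constant
  \<bar>t\<bar>; on it they differ by at most 2.\<close>

lemma char_distr_diff_le:
  fixes X Y :: "'a \<Rightarrow> real"
  assumes [measurable]: "random_variable borel X" "random_variable borel Y" and e: "e \<ge> 0"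
  shows "cmod (char (distr M borel X) t - char (distr M borel Y) t)
    \<le> \<bar>t\<bar> * e + 2 * prob {\<omega>\<in>space M. e \<le> \<bar>X \<omega> - Y \<omega>\<bar>}"
proof -
  let ?B = "{\<omega>\<in>space M. e \<le> \<bar>X \<omega> - Y \<omega>\<bar>}"
  have int: "integrable M (\<lambda>\<omega>. iexp (t * Z \<omega>))" if [measurable]: "random_variable borel Z" for Z
    by (rule integrable_const_bound[of _ 1]) auto
  have "cmod (char (distr M borel X) t - char (distr M borel Y) t)
      = cmod (\<integral>\<omega>. iexp (t * X \<omega>) - iexp (t * Y \<omega>) \<partial>M)"
    using int by (simp add: char_def integral_distr)
  also have "\<dots> \<le> expectation (\<lambda>\<omega>. cmod (iexp (t * X \<omega>) - iexp (t * Y \<omega>)))"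
    by (rule integral_norm_bound)
  also have "\<dots> \<le> expectation (\<lambda>\<omega>. \<bar>t\<bar> * e + 2 * indicator ?B \<omega>)"
  proof (rule integral_mono)
    show "integrable M (\<lambda>\<omega>. cmod (iexp (t * X \<omega>) - iexp (t * Y \<omega>)))"
      using int by (intro integrable_norm Bochner_Integration.integrable_diff) auto
    show "integrable M (\<lambda>\<omega>. \<bar>t\<bar> * e + 2 * indicator ?B \<omega>)"
      by (intro Bochner_Integration.integrable_add integrable_mult_right integrable_real_indicator)
        (auto simp: emeasure_eq_measure)
    fix \<omega> assume \<omega>: "\<omega> \<in> space M"
    show "cmod (iexp (t * X \<omega>) - iexp (t * Y \<omega>)) \<le> \<bar>t\<bar> * e + 2 * indicator ?B \<omega>"
    proof (cases "\<omega> \<in> ?B")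
      case True
      have "cmod (iexp (t * X \<omega>) - iexp (t * Y \<omega>)) \<le> 1 + 1"
        by (rule order_trans[OF norm_triangle_ineq4]) simp
      moreover have "0 \<le> \<bar>t\<bar> * e" using e by simp
      ultimately show ?thesis using True by simp
    next
      case False
      have "iexp (t * X \<omega>) - iexp (t * Y \<omega>) = iexp (t * Y \<omega>) * (iexp (t * (X \<omega> - Y \<omega>)) - 1)"
        by (simp add: algebra_simps flip: exp_add)
      then have "cmod (iexp (t * X \<omega>) - iexp (t * Y \<omega>)) = cmod (iexp (t * (X \<omega> - Y \<omega>)) - 1)"
        by (simp add: norm_mult)
      also have "\<dots> \<le> \<bar>t * (X \<omega> - Y \<omega>)\<bar>" using iexp_approx1[of "t * (X \<omega> - Y \<omega>)" 0] by simp
      also have "\<dots> \<le> \<bar>t\<bar> * e" using False \<omega> by (auto simp: abs_mult intro!: mult_left_mono)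
      finally show ?thesis using False by simp
    qed
  qed
  also have "\<dots> = \<bar>t\<bar> * e + 2 * prob ?B"
    by (subst Bochner_Integration.integral_add) (auto simp: prob_space emeasure_eq_measure Int_absorb1)
  finally show ?thesis .
qed

text \<open>The part of Slutsky's theorem needed here: a perturbation tending to 0 in probability
  does not affect the limit of the characteristic functions.\<close>

lemma char_distr_diff_tendsto_0:
  fixes X Y :: "nat \<Rightarrow> 'a \<Rightarrow> real"
  assumes rv: "\<And>n. random_variable borel (X n)" "\<And>n. random_variable borel (Y n)"
    and P: "\<And>e. e > 0 \<Longrightarrow> (\<lambda>n. prob {\<omega>\<in>space M. e \<le> \<bar>X n \<omega> - Y n \<omega>\<bar>}) \<longlonglongrightarrow> 0"
  shows "(\<lambda>n. char (distr M borel (X n)) t - char (distr M borel (Y n)) t) \<longlonglongrightarrow> 0"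
proof (rule tendstoI)
  fix d :: real assume d: "d > 0"
  define e where "e = d / (2 * (\<bar>t\<bar> + 1))"
  have e: "e > 0" "\<bar>t\<bar> * e < d / 2" using d by (auto simp: e_def field_simps)
  have "\<forall>\<^sub>F n in sequentially. prob {\<omega>\<in>space M. e \<le> \<bar>X n \<omega> - Y n \<omega>\<bar>} < d / 4"
    using order_tendstoD(2)[OF P[OF e(1)], of "d / 4"] d by simp
  then show "\<forall>\<^sub>F n in sequentially. dist (char (distr M borel (X n)) t - char (distr M borel (Y n)) t) 0 < d"
  proof eventually_elim
    case (elim n)
    then show ?case
      using char_distr_diff_le[OF rv(1)[of n] rv(2)[of n] less_imp_le[OF e(1)], of t] e(2) by simp
  qed
qed

text \<open>The summands of a transform by predictable weights \<open>H\<close> are orthogonal in \<open>L\<^sup>2\<close>.\<close>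

lemma predictable_transform_second_moment:
  fixes R :: "nat \<Rightarrow> 'a \<Rightarrow> 'b" and f :: "nat \<Rightarrow> 'b \<Rightarrow> real" and H :: "nat \<Rightarrow> (nat \<Rightarrow> 'b) \<Rightarrow> real"
  assumes indep: "indep_vars S R {m..}" and a: "m \<le> a"
    and H[measurable]: "\<And>n. n \<ge> m \<Longrightarrow> H n \<in> borel_measurable (PiM {m..<n} S)"
    and H1: "\<And>n x. \<bar>H n x\<bar> \<le> 1"
    and f[measurable]: "\<And>n. n \<ge> m \<Longrightarrow> f n \<in> borel_measurable (S n)"
    and f1: "\<And>n x. n \<ge> m \<Longrightarrow> \<bar>f n x\<bar> \<le> 1"
    and mean: "\<And>n. n \<ge> m \<Longrightarrow> expectation (\<lambda>\<omega>. f n (R n \<omega>)) = 0"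
  shows "expectation (\<lambda>\<omega>. (\<Sum>n=a..<b. H n (\<lambda>i\<in>{m..<n}. R i \<omega>) * f n (R n \<omega>))\<^sup>2)
    \<le> (\<Sum>n=a..<b. expectation (\<lambda>\<omega>. (f n (R n \<omega>))\<^sup>2))"
proof (induction b)
  case 0
  show ?case by simp
next
  case (Suc b)
  have R[measurable]: "R n \<in> measurable M (S n)" if "n \<ge> m" for n
    using indep that by (simp add: indep_vars_def2)
  show ?case
  proof (cases "a \<le> b")
    case False
    then show ?thesis by simp
  next
    case True
    define h where "h n \<omega> = H n (\<lambda>i\<in>{m..<n}. R i \<omega>)" for n \<omega>
    define X where "X n \<omega> = f n (R n \<omega>)" for n \<omega>
    define U where "U \<omega> = (\<Sum>n=a..<b. h n \<omega> * X n \<omega>)" for \<omega>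
    \<comment> \<open>Writes \<open>U * h b\<close> as a function of the coordinates before
      \<open>b\<close> alone, so that its independence from \<open>R b\<close> follows from that of
      disjoint blocks of indices.\<close>
    define G where "G x = (\<Sum>n=a..<b. H n (\<lambda>i\<in>{m..<n}. x i) * f n (x n)) * H b x" for x
    have h1: "\<bar>h n \<omega>\<bar> \<le> 1" for n \<omega> by (simp add: h_def H1)
    have X1: "\<bar>X n \<omega>\<bar> \<le> 1" if "n \<ge> m" for n \<omega> using that by (simp add: X_def f1)
    have rh[measurable]: "random_variable borel (h n)" if n: "n \<ge> m" for n
      unfolding h_def by (rule measurable_compose[OF measurable_restrict H[OF n]]) (auto intro: R)
    have rX[measurable]: "random_variable borel (X n)" if n: "n \<ge> m" for n
      unfolding X_def by (rule measurable_compose[OF R f]) (use n in auto)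
    have rU[measurable]: "random_variable borel U"
      unfolding U_def using a by (intro borel_measurable_sum borel_measurable_times rh rX) auto
    have U1: "\<bar>U \<omega>\<bar> \<le> real b" for \<omega>
    proof -
      have "\<bar>U \<omega>\<bar> \<le> (\<Sum>n=a..<b. \<bar>h n \<omega> * X n \<omega>\<bar>)" unfolding U_def by (rule sum_abs)
      also have "\<dots> \<le> (\<Sum>n=a..<b. 1)" using h1 X1 a by (intro sum_mono) (simp add: abs_mult mult_le_one)
      finally show ?thesis by simp
    qed
    have bm: "b \<ge> m" using a True by simp
    have G[measurable]: "G \<in> borel_measurable (PiM {m..<b} S)"
      unfolding G_def
    proof (intro borel_measurable_times borel_measurable_sum H bm)
      fix n assume n: "n \<in> {a..<b}"
      show "(\<lambda>x. H n (\<lambda>i\<in>{m..<n}. x i)) \<in> borel_measurable (PiM {m..<b} S)"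
        using n a by (intro measurable_compose[OF measurable_restrict_subset H]) auto
      show "(\<lambda>x. f n (x n)) \<in> borel_measurable (PiM {m..<b} S)"
        using n a by (intro measurable_compose[OF measurable_component_singleton[of n _ S] f[of n]]) auto
    qed
    have GR: "G (\<lambda>i\<in>{m..<b}. R i \<omega>) = U \<omega> * h b \<omega>" for \<omega>
    proof -
      have "(\<Sum>n=a..<b. H n (\<lambda>i\<in>{m..<n}. (\<lambda>i\<in>{m..<b}. R i \<omega>) i) * f n ((\<lambda>i\<in>{m..<b}. R i \<omega>) n)) = U \<omega>"
        unfolding U_def h_def X_def
      proof (rule sum.cong[OF refl])
        fix n assume n: "n \<in> {a..<b}"
        have "(\<lambda>i\<in>{m..<n}. (\<lambda>i\<in>{m..<b}. R i \<omega>) i) = (\<lambda>i\<in>{m..<n}. R i \<omega>)"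
          using n by (auto simp: restrict_def)
        then show "H n (\<lambda>i\<in>{m..<n}. (\<lambda>i\<in>{m..<b}. R i \<omega>) i) * f n ((\<lambda>i\<in>{m..<b}. R i \<omega>) n)
            = H n (\<lambda>i\<in>{m..<n}. R i \<omega>) * f n (R n \<omega>)" using n a by simp
      qed
      then show ?thesis by (simp add: G_def h_def)
    qed
    have "indep_var (PiM {m..<b} S) (\<lambda>\<omega>. \<lambda>i\<in>{m..<b}. R i \<omega>) (PiM {b} S) (\<lambda>\<omega>. \<lambda>i\<in>{b}. R i \<omega>)"
      using bm by (intro indep_var_restrict[OF indep]) auto
    then have "indep_var borel (G \<circ> (\<lambda>\<omega>. \<lambda>i\<in>{m..<b}. R i \<omega>)) borel ((\<lambda>x. f b (x b)) \<circ> (\<lambda>\<omega>. \<lambda>i\<in>{b}. R i \<omega>))"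
    proof (rule indep_var_compose)
      show "(\<lambda>x. f b (x b)) \<in> borel_measurable (PiM {b} S)"
        using bm by (intro measurable_compose[OF measurable_component_singleton[of b _ S] f[of b]]) auto
    qed fact
    then have ind: "indep_var borel (\<lambda>\<omega>. U \<omega> * h b \<omega>) borel (X b)"
      by (simp add: comp_def GR X_def[abs_def])
    have bU2: "\<bar>(U \<omega>)\<^sup>2\<bar> \<le> (real b)\<^sup>2" for \<omega> using power_mono[OF U1[of \<omega>], of 2] by simp
    have bUh: "\<bar>U \<omega> * h b \<omega>\<bar> \<le> real b" for \<omega>
      using mult_mono[OF U1[of \<omega>] h1[of b \<omega>]] by (simp add: abs_mult)
    have bUhX: "\<bar>U \<omega> * h b \<omega> * X b \<omega>\<bar> \<le> real b" for \<omega>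
      using mult_mono[OF bUh[of \<omega>] X1[OF bm, of \<omega>]] by (simp add: abs_mult)
    have bX2: "\<bar>(X b \<omega>)\<^sup>2\<bar> \<le> 1" for \<omega> using power_mono[OF X1[OF bm, of \<omega>], of 2] by simp
    have hX: "(h b \<omega> * X b \<omega>)\<^sup>2 \<le> (X b \<omega>)\<^sup>2" for \<omega>
      using mult_right_mono[OF power_mono[OF h1[of b \<omega>], of 2], of "(X b \<omega>)\<^sup>2"]
      by (simp add: power_mult_distrib)
    note rr = rU rh[OF bm] rX[OF bm]
    have iU2: "integrable M (\<lambda>\<omega>. (U \<omega>)\<^sup>2)"
      by (rule integrable_const_bound[of _ "(real b)\<^sup>2"]) (use rr bU2 in auto)
    have iX: "integrable M (X b)" by (rule integrable_const_bound[of _ 1]) (use rr X1[OF bm] in auto)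
    have iUh: "integrable M (\<lambda>\<omega>. U \<omega> * h b \<omega>)"
      by (rule integrable_const_bound[of _ "real b"]) (use rr bUh in auto)
    have iUhX: "integrable M (\<lambda>\<omega>. U \<omega> * h b \<omega> * X b \<omega>)"
      by (rule integrable_const_bound[of _ "real b"]) (use rr bUhX in auto)
    have iX2: "integrable M (\<lambda>\<omega>. (X b \<omega>)\<^sup>2)"
      by (rule integrable_const_bound[of _ 1]) (use rr bX2 in auto)
    \<comment> \<open>Orthogonality: the new term is independent of the past and has mean 0. The
      weight in the remaining square only decreases it.\<close>
    have cross: "expectation (\<lambda>\<omega>. U \<omega> * h b \<omega> * X b \<omega>) = 0"
      using indep_var_lebesgue_integral[OF ind iUh iX] mean[OF bm] by (simp add: X_def)
    have "expectation (\<lambda>\<omega>. (\<Sum>n=a..<Suc b. h n \<omega> * X n \<omega>)\<^sup>2)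
        \<le> expectation (\<lambda>\<omega>. (U \<omega>)\<^sup>2 + 2 * (U \<omega> * h b \<omega> * X b \<omega>) + (X b \<omega>)\<^sup>2)"
    proof (rule integral_mono')
      show "integrable M (\<lambda>\<omega>. (U \<omega>)\<^sup>2 + 2 * (U \<omega> * h b \<omega> * X b \<omega>) + (X b \<omega>)\<^sup>2)"
        using iU2 iUhX iX2 by auto
      fix \<omega>
      have "(\<Sum>n=a..<Suc b. h n \<omega> * X n \<omega>)\<^sup>2 = (U \<omega>)\<^sup>2 + 2 * (U \<omega> * h b \<omega> * X b \<omega>) + (h b \<omega> * X b \<omega>)\<^sup>2"
        using True by (simp add: U_def power2_sum)
      then show le: "(\<Sum>n=a..<Suc b. h n \<omega> * X n \<omega>)\<^sup>2 \<le> (U \<omega>)\<^sup>2 + 2 * (U \<omega> * h b \<omega> * X b \<omega>) + (X b \<omega>)\<^sup>2"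
        using hX[of \<omega>] by simp
      show "0 \<le> (U \<omega>)\<^sup>2 + 2 * (U \<omega> * h b \<omega> * X b \<omega>) + (X b \<omega>)\<^sup>2"
        using order_trans[OF zero_le_power2 le] .
    qed
    also have "\<dots> = expectation (\<lambda>\<omega>. (U \<omega>)\<^sup>2) + expectation (\<lambda>\<omega>. (X b \<omega>)\<^sup>2)"
      using iU2 iUhX iX2 cross by (simp del: integral_mult_right_zero)
    finally have fin: "expectation (\<lambda>\<omega>. (\<Sum>n=a..<Suc b. h n \<omega> * X n \<omega>)\<^sup>2)
        \<le> expectation (\<lambda>\<omega>. (U \<omega>)\<^sup>2) + expectation (\<lambda>\<omega>. (X b \<omega>)\<^sup>2)" .
    have IH: "expectation (\<lambda>\<omega>. (U \<omega>)\<^sup>2) \<le> (\<Sum>n=a..<b. expectation (\<lambda>\<omega>. (X n \<omega>)\<^sup>2))"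
      using Suc.IH by (simp only: U_def h_def X_def)
    have "expectation (\<lambda>\<omega>. (\<Sum>n=a..<Suc b. h n \<omega> * X n \<omega>)\<^sup>2)
        \<le> (\<Sum>n=a..<Suc b. expectation (\<lambda>\<omega>. (X n \<omega>)\<^sup>2))"
      using order_trans[OF fin add_right_mono[OF IH]] True by (simp only: sum.atLeastLessThan_Suc)
    then show ?thesis by (simp only: h_def X_def)
  qed
qed

text \<open>Chebyshev's inequality around 0; boundedness supplies the integrability.\<close>

lemma prob_abs_ge_le_second_moment:
  assumes "random_variable borel U" "\<And>\<omega>. \<bar>U \<omega>\<bar> \<le> (B::real)" "e > 0"
  shows "prob {\<omega>\<in>space M. e \<le> \<bar>U \<omega>\<bar>} \<le> expectation (\<lambda>\<omega>. (U \<omega>)\<^sup>2) / e\<^sup>2"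
proof (rule second_moment_method)
  have "\<bar>(U \<omega>)\<^sup>2\<bar> \<le> B\<^sup>2" for \<omega> using power_mono[OF assms(2)[of \<omega>], of 2] by simp
  then show "integrable M (\<lambda>\<omega>. (U \<omega>)\<^sup>2)"
    using assms(1) by (intro integrable_const_bound[of _ "B\<^sup>2"]) auto
qed (use assms in auto)

end

section \<open>The random model\<close>

text \<open>The induction follows the recursion of \<open>enumerate\<close> and is general in the
  random set, since each step deletes its least element.\<close>

lemma measurable_enumerate:
  fixes S :: "'a \<Rightarrow> nat set"
  assumes "\<And>n. Measurable.pred M (\<lambda>\<omega>. n \<in> S \<omega>)"
  shows "(\<lambda>\<omega>. enumerate (S \<omega>) N) \<in> measurable M (count_space UNIV)"
  using assms
proof (induction N arbitrary: S)
  case 0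
  note [measurable] = 0
  show ?case unfolding enumerate_0 by measurable
next
  case (Suc N)
  note [measurable] = Suc.prems
  have "Measurable.pred M (\<lambda>\<omega>. n \<in> S \<omega> - {LEAST n. n \<in> S \<omega>})" for n
    unfolding Diff_iff singleton_iff by measurable
  from Suc.IH[OF this] show ?case unfolding enumerate_Suc .
qed

text \<open>The argument is a sequence rather than a sample point, so that the count is a measurable
  function on the product space of the coordinates before \<open>j\<close>; this expresses
  predictability.\<close>

definition pseudo_prime_count :: "nat \<Rightarrow> (nat \<Rightarrow> real) \<Rightarrow> real" where
  "pseudo_prime_count j x = (\<Sum>n=3..<j. if x n \<le> 1 / ln (real n) then 1 else 0)"

text \<open>The coefficient \<open>c\<close> is left open: it is the real part of the character for
  the main sum and 1 for the counting function.\<close>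

definition centered_term :: "(nat \<Rightarrow> real) \<Rightarrow> nat \<Rightarrow> real \<Rightarrow> real" where
  "centered_term c n x = c n * ((if x \<le> 1 / ln (real n) then 1 else 0) - 1 / ln (real n))"

lemma abs_centered_term_le: "\<bar>centered_term c n x\<bar> \<le> 1" if "n \<ge> 3" "\<bar>c n\<bar> \<le> 1"
proof -
  have "\<bar>(if x \<le> 1 / ln (real n) then 1 else 0) - 1 / ln (real n)\<bar> \<le> 1"
    using inverse_ln_bounds[OF that(1)] by auto
  then show ?thesis using that(2) unfolding centered_term_def abs_mult by (rule mult_le_one[rotated 2]) auto
qed

lemma borel_measurable_centered_term [measurable]: "centered_term c n \<in> borel_measurable borel"
  unfolding centered_term_def by measurable

lemma pseudo_prime_count_eq_card:
  "pseudo_prime_count j (\<lambda>n. r n \<omega>) = real (card (pseudo_primes r \<omega> \<inter> {..<j}))"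
proof -
  have "pseudo_primes r \<omega> \<inter> {..<j} = {n\<in>{3..<j}. r n \<omega> \<le> 1 / ln (real n)}"
    by (auto simp: pseudo_primes_def)
  then show ?thesis by (simp add: pseudo_prime_count_def flip: sum.inter_filter)
qed

text \<open>A pathwise identity up to the centering. The two counting conditions place the random
  endpoint in the window from \<open>a\<close> to \<open>b\<close>; inside it the endpoint is
  encoded by predictable 0-1 weights. What remains is the sum of the means up to the endpoint, at
  most \<open>K\<close> wherever that lies.\<close>

lemma pseudo_prime_cos_sum_decomposition:
  assumes N: "N \<ge> 1" and a: "3 \<le> a"
    and count: "pseudo_prime_count a (\<lambda>n. r n \<omega>) < real N" "real N \<le> pseudo_prime_count b (\<lambda>n. r n \<omega>)"
    and c: "\<And>n. c n = (if coprime n k then cos (\<theta> n) else 0)"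
    and K: "\<And>m. \<bar>\<Sum>n=3..<m. c n * (1 / ln (real n))\<bar> \<le> K"
  shows "\<bar>pseudo_prime_cos_sum r k \<theta> N \<omega> - (\<Sum>n=3..<a. centered_term c n (r n \<omega>))
    - (\<Sum>n=a..<b. (if pseudo_prime_count n (\<lambda>n. r n \<omega>) < real N then 1 else 0) * centered_term c n (r n \<omega>))\<bar> \<le> K"
proof -
  define T where "T = nth_pseudo_prime r N \<omega>"
  define X where "X n = centered_term c n (r n \<omega>)" for n
  \<comment> \<open>\<open>enumerate\<close> counts from 0, so "at most \<open>N - 1\<close>
    elements below \<open>j\<close>" becomes a count strictly less than \<open>N\<close>.\<close>
  have T: "j \<le> T \<longleftrightarrow> pseudo_prime_count j (\<lambda>n. r n \<omega>) < real N" for j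
  proof -
    have "N - 1 < card (pseudo_primes r \<omega> \<inter> {..<b})"
      using count(2) N unfolding pseudo_prime_count_eq_card by linarith
    from le_enumerate_iff[OF this, of j] show ?thesis
      using N unfolding T_def nth_pseudo_prime_def pseudo_prime_count_eq_card by auto
  qed
  have aT: "a \<le> T" and Tb: "T < b" using T[of a] T[of b] count by auto
  have "pseudo_prime_cos_sum r k \<theta> N \<omega> = (\<Sum>n=3..<Suc T. X n + c n * (1 / ln (real n)))"
    unfolding pseudo_prime_cos_sum_def T_def[symmetric] atLeastLessThanSuc_atLeastAtMost
    by (intro sum.cong) (auto simp: pseudo_prime_coprime_ind_def X_def centered_term_def c algebra_simps)
  also have "\<dots> = (\<Sum>n=3..<Suc T. X n) + (\<Sum>n=3..<Suc T. c n * (1 / ln (real n)))"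
    by (rule sum.distrib)
  also have "(\<Sum>n=3..<Suc T. X n) = (\<Sum>n=3..<a. X n) + (\<Sum>n=a..<Suc T. X n)"
    using a aT by (intro sum.atLeastLessThan_concat[symmetric]) auto
  also have "(\<Sum>n=a..<Suc T. X n) = (\<Sum>n=a..<Suc T. (if n \<le> T then 1 else 0) * X n)"
    by (intro sum.cong) auto
  also have "\<dots> = (\<Sum>n=a..<b. (if n \<le> T then 1 else 0) * X n)"
    using Tb by (intro sum.mono_neutral_left) auto
  finally show ?thesis using K[of "Suc T"] by (simp add: T X_def)
qed

section \<open>Moments, deviations and measurability in the model\<close>

locale pseudo_prime_model = prob_space M for M :: "'a measure" +
  fixes r :: "nat \<Rightarrow> 'a \<Rightarrow> real"
  assumes indep: "indep_vars (\<lambda>_. borel) r {3..}"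
    and uniform: "\<And>n. n \<ge> 3 \<Longrightarrow> distr M borel (r n) = uniform_measure lborel {0..1}"
begin

lemma rv: "random_variable borel (r n)" if "n \<ge> 3"
  using indep that by (simp add: indep_vars_def2)

lemma prob_le_threshold:
  assumes "n \<ge> 3" "0 \<le> x" "x \<le> 1"
  shows "prob {\<omega>\<in>space M. r n \<omega> \<le> x} = x"
proof -
  have "prob {\<omega>\<in>space M. r n \<omega> \<le> x} = measure (distr M borel (r n)) {..x}"
    using rv[OF assms(1)] by (subst measure_distr) (auto intro!: arg_cong[where f=prob])
  also have "\<dots> = measure lborel ({0..1} \<inter> {..x})"
    by (simp add: uniform[OF assms(1)])
  also have "{0..1} \<inter> {..x} = {0..x}" using assms by auto
  finally show ?thesis using assms by simp
qed

lemma
  assumes n: "n \<ge> 3"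
  shows expectation_centered_term: "expectation (\<lambda>\<omega>. centered_term c n (r n \<omega>)) = 0"
    and second_moment_centered_term: "expectation (\<lambda>\<omega>. (centered_term c n (r n \<omega>))\<^sup>2)
      = (c n)\<^sup>2 * (1 / ln (real n) - (1 / ln (real n))\<^sup>2)"
proof -
  define p where "p = 1 / ln (real n)"
  define Z where "Z = (indicator {\<omega>\<in>space M. r n \<omega> \<le> p} :: 'a \<Rightarrow> real)"
  note [measurable] = rv[OF n]
  have p: "0 \<le> p" "p \<le> 1" using inverse_ln_bounds[OF n] by (auto simp: p_def)
  have iZ: "integrable M Z" unfolding Z_def by (intro integrable_real_indicator) (auto simp: emeasure_eq_measure)
  have EZ: "expectation Z = p"
    unfolding Z_def using prob_le_threshold[OF n p] by (auto simp: Int_absorb1)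
  have ct: "centered_term c n (r n \<omega>) = c n * (Z \<omega> - p)" if "\<omega> \<in> space M" for \<omega>
    using that by (simp add: centered_term_def Z_def p_def)
  have "expectation (\<lambda>\<omega>. centered_term c n (r n \<omega>)) = expectation (\<lambda>\<omega>. c n * (Z \<omega> - p))"
    by (intro Bochner_Integration.integral_cong) (auto simp: ct)
  also have "\<dots> = 0" using iZ by (simp add: EZ prob_space)
  finally show "expectation (\<lambda>\<omega>. centered_term c n (r n \<omega>)) = 0" .
  \<comment> \<open>The indicator \<open>Z\<close> is its own square, so the squared term is affine
    in \<open>Z\<close>.\<close>
  have "expectation (\<lambda>\<omega>. (centered_term c n (r n \<omega>))\<^sup>2)
      = expectation (\<lambda>\<omega>. (c n)\<^sup>2 * ((1 - 2 * p) * Z \<omega> + p\<^sup>2))"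
    by (intro Bochner_Integration.integral_cong)
      (auto simp: ct Z_def power2_eq_square algebra_simps split: split_indicator)
  also have "\<dots> = (c n)\<^sup>2 * ((1 - 2 * p) * p + p\<^sup>2)" using iZ by (simp add: EZ prob_space)
  finally show "expectation (\<lambda>\<omega>. (centered_term c n (r n \<omega>))\<^sup>2)
      = (c n)\<^sup>2 * (1 / ln (real n) - (1 / ln (real n))\<^sup>2)"
    by (simp add: p_def[symmetric] power2_eq_square algebra_simps)
qed

text \<open>By orthogonality only the individual variances count, and each is at most 1 / ln n. The
  bound is the expected number of pseudo-primes in the window.\<close>

lemma second_moment_transform_le:
  assumes a: "3 \<le> a" "a \<le> b" and c: "\<And>n. \<bar>c n\<bar> \<le> 1"
    and H: "\<And>n. n \<ge> 3 \<Longrightarrow> H n \<in> borel_measurable (PiM {3..<n} (\<lambda>_. borel))" "\<And>n x. \<bar>H n x\<bar> \<le> 1"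
  shows "expectation (\<lambda>\<omega>. (\<Sum>n=a..<b. H n (\<lambda>i\<in>{3..<n}. r i \<omega>) * centered_term c n (r n \<omega>))\<^sup>2)
    \<le> li_sum b - li_sum a"
proof -
  have "expectation (\<lambda>\<omega>. (\<Sum>n=a..<b. H n (\<lambda>i\<in>{3..<n}. r i \<omega>) * centered_term c n (r n \<omega>))\<^sup>2)
      \<le> (\<Sum>n=a..<b. expectation (\<lambda>\<omega>. (centered_term c n (r n \<omega>))\<^sup>2))"
    by (rule predictable_transform_second_moment[OF indep a(1) H])
      (use c in \<open>auto simp: expectation_centered_term abs_centered_term_le\<close>)
  also have "\<dots> \<le> (\<Sum>n=a..<b. 1 / ln (real n))"
  proof (rule sum_mono)
    fix n assume n: "n \<in> {a..<b}"
    then have p: "0 < 1 / ln (real n)" "1 / ln (real n) \<le> 1" using a inverse_ln_bounds[of n] by auto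
    have "(c n)\<^sup>2 \<le> 1" using c[of n] by (simp add: abs_square_le_1)
    moreover have "(1 / ln (real n))\<^sup>2 \<le> 1 / ln (real n)"
      unfolding power2_eq_square using p by (intro mult_left_le) auto
    ultimately have "(c n)\<^sup>2 * (1 / ln (real n) - (1 / ln (real n))\<^sup>2) \<le> 1 * (1 / ln (real n) - 0)"
      by (intro mult_mono) auto
    then show "expectation (\<lambda>\<omega>. (centered_term c n (r n \<omega>))\<^sup>2) \<le> 1 / ln (real n)"
      using second_moment_centered_term[of n c] n a by simp
  qed
  also have "\<dots> = li_sum b - li_sum a" using li_sum_diff[OF a] by simp
  finally show ?thesis .
qed

lemma borel_measurable_count: "random_variable borel (\<lambda>\<omega>. pseudo_prime_count j (\<lambda>n. r n \<omega>))"
  unfolding pseudo_prime_count_def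
proof (intro borel_measurable_sum)
  fix n assume "n \<in> {3..<j}"
  then have [measurable]: "random_variable borel (r n)" by (intro rv) simp
  show "random_variable borel (\<lambda>\<omega>. if r n \<omega> \<le> 1 / ln (real n) then 1 else (0::real))" by measurable
qed

lemma prob_count_deviation_le:
  assumes j: "3 \<le> j" and e: "e > 0"
  shows "prob {\<omega>\<in>space M. e \<le> \<bar>pseudo_prime_count j (\<lambda>n. r n \<omega>) - li_sum j\<bar>} \<le> li_sum j / e\<^sup>2"
proof -
  let ?U = "\<lambda>\<omega>. pseudo_prime_count j (\<lambda>n. r n \<omega>) - li_sum j"
  \<comment> \<open>The centered count is the transform with all coefficients and weights 1; the
    factor 1 is kept to match its shape.\<close>
  have eq: "?U \<omega> = (\<Sum>n=3..<j. 1 * centered_term (\<lambda>_. 1) n (r n \<omega>))" for \<omega>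
    by (simp add: pseudo_prime_count_def li_sum_def centered_term_def sum_subtractf)
  have bd: "\<bar>?U \<omega>\<bar> \<le> real j" for \<omega>
  proof -
    have "\<bar>?U \<omega>\<bar> \<le> (\<Sum>n=3..<j. \<bar>1 * centered_term (\<lambda>_. 1) n (r n \<omega>)\<bar>)" unfolding eq by (rule sum_abs)
    also have "\<dots> \<le> (\<Sum>n=3..<j. 1)" by (intro sum_mono) (simp add: abs_centered_term_le)
    finally show ?thesis using j by simp
  qed
  have "prob {\<omega>\<in>space M. e \<le> \<bar>?U \<omega>\<bar>} \<le> expectation (\<lambda>\<omega>. (?U \<omega>)\<^sup>2) / e\<^sup>2"
    using borel_measurable_count e bd by (intro prob_abs_ge_le_second_moment) auto
  also have "expectation (\<lambda>\<omega>. (?U \<omega>)\<^sup>2) \<le> li_sum j - li_sum 3"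
    using second_moment_transform_le[of 3 j "\<lambda>_. 1" "\<lambda>_ _. 1"] j unfolding eq by simp
  finally show ?thesis using e by (simp add: li_sum_def divide_right_mono)
qed

text \<open>The upper limit of the sum is random but takes values in a countable set, so fixed
  limits suffice.\<close>

lemma borel_measurable_pseudo_prime_cos_sum:
  "random_variable borel (pseudo_prime_cos_sum r k \<theta> N)"
proof -
  have "Measurable.pred M (\<lambda>\<omega>. n \<in> pseudo_primes r \<omega>)" for n
  proof (cases "n \<ge> 3")
    case True
    note [measurable] = rv[OF True]
    show ?thesis using True unfolding pseudo_primes_def mem_Collect_eq by measurable
  qed (simp add: pseudo_primes_def)
  then have T: "nth_pseudo_prime r N \<in> measurable M (count_space UNIV)"
    unfolding nth_pseudo_prime_def by (rule measurable_enumerate)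
  have "random_variable borel (\<lambda>\<omega>. \<Sum>n = 3..m. pseudo_prime_coprime_ind r k n \<omega> * cos (\<theta> n))" for m
  proof (intro borel_measurable_sum)
    fix n assume "n \<in> {3..m}"
    then have [measurable]: "random_variable borel (r n)" by (intro rv) simp
    show "random_variable borel (\<lambda>\<omega>. pseudo_prime_coprime_ind r k n \<omega> * cos (\<theta> n))"
      unfolding pseudo_prime_coprime_ind_def by measurable
  qed
  from measurable_compose_countable[OF this T] show ?thesis
    unfolding pseudo_prime_cos_sum_def .
qed

lemma borel_measurable_transform:
  assumes "3 \<le> a"
  shows "random_variable borel (\<lambda>\<omega>. \<Sum>n=a..<b.
    (if pseudo_prime_count n (\<lambda>n. r n \<omega>) < y then 1 else 0) * centered_term c n (r n \<omega>))"
proof (intro borel_measurable_sum)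
  fix n assume "n \<in> {a..<b}"
  then have [measurable]: "random_variable borel (r n)" using assms by (intro rv) simp
  note [measurable] = borel_measurable_count
  show "random_variable borel (\<lambda>\<omega>. (if pseudo_prime_count n (\<lambda>n. r n \<omega>) < y then 1 else 0) * centered_term c n (r n \<omega>))"
    by measurable
qed

lemma prob_transform_le:
  assumes a: "3 \<le> a" "a \<le> b" and c: "\<And>n. \<bar>c n\<bar> \<le> 1" and e: "e > 0"
  shows "prob {\<omega>\<in>space M. e \<le> \<bar>C * (\<Sum>n=a..<b.
    (if pseudo_prime_count n (\<lambda>n. r n \<omega>) < y then 1 else 0) * centered_term c n (r n \<omega>))\<bar>}
    \<le> C\<^sup>2 * (li_sum b - li_sum a) / e\<^sup>2" (is "prob {\<omega>\<in>_. e \<le> \<bar>C * ?U \<omega>\<bar>} \<le> _")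
proof -
  have bd: "\<bar>C * ?U \<omega>\<bar> \<le> \<bar>C\<bar> * real b" for \<omega>
  proof -
    have "\<bar>?U \<omega>\<bar> \<le> (\<Sum>n=a..<b. 1)"
      using a c by (intro order_trans[OF sum_abs] sum_mono) (auto simp: abs_centered_term_le)
    then show ?thesis unfolding abs_mult by (intro mult_left_mono) auto
  qed
  have "expectation (\<lambda>\<omega>. (?U \<omega>)\<^sup>2) \<le> li_sum b - li_sum a"
  proof -
    define H where "H n x = (if pseudo_prime_count n x < y then 1 else 0 :: real)" for n x
    have H: "H n \<in> borel_measurable (PiM {3..<n} (\<lambda>_. borel))" for n
    proof -
      have [measurable]: "pseudo_prime_count n \<in> borel_measurable (PiM {3..<n} (\<lambda>_. borel))"
        unfolding pseudo_prime_count_def by measurable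
      show ?thesis unfolding H_def by measurable
    qed
    \<comment> \<open>Predictability: the weight at \<open>n\<close> involves only the coordinates
      before \<open>n\<close>.\<close>
    have "pseudo_prime_count n (\<lambda>i\<in>{3..<n}. r i \<omega>) = pseudo_prime_count n (\<lambda>n. r n \<omega>)" for n \<omega>
      unfolding pseudo_prime_count_def by (intro sum.cong) auto
    with second_moment_transform_le[OF a c H] show ?thesis by (simp add: H_def)
  qed
  then have "C\<^sup>2 * expectation (\<lambda>\<omega>. (?U \<omega>)\<^sup>2) / e\<^sup>2 \<le> C\<^sup>2 * (li_sum b - li_sum a) / e\<^sup>2"
    by (intro divide_right_mono mult_left_mono) auto
  moreover have "prob {\<omega>\<in>space M. e \<le> \<bar>C * ?U \<omega>\<bar>} \<le> expectation (\<lambda>\<omega>. (C * ?U \<omega>)\<^sup>2) / e\<^sup>2"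
    using borel_measurable_transform[OF a(1)] e bd
    by (intro prob_abs_ge_le_second_moment borel_measurable_times) auto
  ultimately show ?thesis by (simp add: power_mult_distrib)
qed

end

section \<open>Normalisation and localisation of the index\<close>

definition clt_scale :: "real \<Rightarrow> nat \<Rightarrow> real" where
  "clt_scale s N = sqrt ((1 + ln (ln (real N)) / ln (real N)) / (s * real N))"

text \<open>The first limit makes the single summands and the centering error negligible, the second
  normalises the variance, and the third disposes of the window around the random index.\<close>

lemma clt_scale_asymp:
  assumes s: "s > 0"
  shows "clt_scale s \<longlonglongrightarrow> 0"
    and "(\<lambda>N. (clt_scale s N)\<^sup>2 * real N) \<longlonglongrightarrow> 1 / s"
    and "(\<lambda>N. (clt_scale s N)\<^sup>2 * (2 * real N powr (3/4) + 1)) \<longlonglongrightarrow> 0"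
proof -
  define D where "D N = (1 + ln (ln (real N)) / ln (real N)) / real N" for N :: nat
  have eq: "clt_scale s N = sqrt (D N / s)" for N by (simp add: clt_scale_def D_def mult.commute)
  have D: "D \<longlonglongrightarrow> 0" "(\<lambda>N. D N * real N) \<longlonglongrightarrow> 1"
    "(\<lambda>N. D N * (2 * real N powr (3/4) + 1)) \<longlonglongrightarrow> 0" unfolding D_def by real_asymp+
  have pos: "\<forall>\<^sub>F N in sequentially. D N \<ge> 0" unfolding D_def by real_asymp
  have sq: "\<forall>\<^sub>F N in sequentially. (clt_scale s N)\<^sup>2 = D N / s"
    using pos by eventually_elim (use s in \<open>simp add: eq\<close>)
  have "(\<lambda>N. sqrt (D N / s)) \<longlonglongrightarrow> sqrt (0 / s)"
    by (intro tendsto_intros D) (use s in simp)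
  then show "clt_scale s \<longlonglongrightarrow> 0" by (simp add: eq[abs_def])
  have "(\<lambda>N. D N * real N / s) \<longlonglongrightarrow> 1 / s" by (intro tendsto_intros D) (use s in simp)
  moreover have "\<forall>\<^sub>F N in sequentially. (clt_scale s N)\<^sup>2 * real N = D N * real N / s"
    using sq by eventually_elim simp
  ultimately show "(\<lambda>N. (clt_scale s N)\<^sup>2 * real N) \<longlonglongrightarrow> 1 / s" by (simp add: tendsto_cong)
  have "(\<lambda>N. D N * (2 * real N powr (3/4) + 1) / s) \<longlonglongrightarrow> 0 / s"
    by (intro tendsto_intros D) (use s in simp)
  moreover have "\<forall>\<^sub>F N in sequentially. (clt_scale s N)\<^sup>2 * (2 * real N powr (3/4) + 1)
      = D N * (2 * real N powr (3/4) + 1) / s"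
    using sq by eventually_elim simp
  ultimately show "(\<lambda>N. (clt_scale s N)\<^sup>2 * (2 * real N powr (3/4) + 1)) \<longlonglongrightarrow> 0" by (simp add: tendsto_cong)
qed

lemma powr_three_quarters_le: "real N powr (3/4) \<le> real N"
proof (cases "N = 0")
  case False
  then have "real N powr (3/4) \<le> real N powr 1" by (intro powr_mono) auto
  then show ?thesis by simp
qed simp

text \<open>The index \<open>p'\<^sub>N\<close> lies between \<open>lower_index N\<close> and \<open>upper_index N\<close> with high probability:
  the window has width \<open>2 N\<^bsup>3/4\<^esup>\<close> on the scale of \<open>li_sum\<close>, well above the \<open>O(N\<^bsup>1/2\<^esup>)\<close> fluctuations
  of the counting function and well below the scale \<open>N\<close> of the variance.\<close>

definition lower_index :: "nat \<Rightarrow> nat" where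
  "lower_index N = (SOME m. m \<ge> 3 \<and> real N - real N powr (3/4) \<le> li_sum m
     \<and> li_sum m \<le> real N - real N powr (3/4) + 1)"

definition upper_index :: "nat \<Rightarrow> nat" where
  "upper_index N = (SOME m. m \<ge> 3 \<and> real N + real N powr (3/4) \<le> li_sum m
     \<and> li_sum m \<le> real N + real N powr (3/4) + 1)"

lemma lower_index:
  "lower_index N \<ge> 3" "real N - real N powr (3/4) \<le> li_sum (lower_index N)"
  "li_sum (lower_index N) \<le> real N - real N powr (3/4) + 1"
proof -
  have "\<exists>m. m \<ge> 3 \<and> real N - real N powr (3/4) \<le> li_sum m \<and> li_sum m \<le> real N - real N powr (3/4) + 1"
    using li_sum_inverse[of "real N - real N powr (3/4)"] powr_three_quarters_le[of N] by auto
  from someI_ex[OF this] show "lower_index N \<ge> 3"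
    "real N - real N powr (3/4) \<le> li_sum (lower_index N)"
    "li_sum (lower_index N) \<le> real N - real N powr (3/4) + 1" by (auto simp: lower_index_def)
qed

lemma upper_index:
  "upper_index N \<ge> 3" "real N + real N powr (3/4) \<le> li_sum (upper_index N)"
  "li_sum (upper_index N) \<le> real N + real N powr (3/4) + 1"
proof -
  have "\<exists>m. m \<ge> 3 \<and> real N + real N powr (3/4) \<le> li_sum m \<and> li_sum m \<le> real N + real N powr (3/4) + 1"
    using li_sum_inverse[of "real N + real N powr (3/4)"] by auto
  from someI_ex[OF this] show "upper_index N \<ge> 3"
    "real N + real N powr (3/4) \<le> li_sum (upper_index N)"
    "li_sum (upper_index N) \<le> real N + real N powr (3/4) + 1" by (auto simp: upper_index_def)
qed

text \<open>The two target values differ by at least 2, more than the overshoot of 1, and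
  \<open>li_sum\<close> is strictly increasing from 3 on.\<close>

lemma lower_index_le_upper_index: "lower_index N \<le> upper_index N" if "N \<ge> 1"
proof (rule ccontr)
  assume *: "\<not> ?thesis"
  have N: "1 \<le> real N powr (3/4)" using that by (simp add: ge_one_powr_ge_zero)
  have "0 < (\<Sum>n=upper_index N..<lower_index N. 1 / ln (real n))"
  proof (rule sum_pos)
    fix n assume "n \<in> {upper_index N..<lower_index N}"
    then show "0 < 1 / ln (real n)" using upper_index(1)[of N] by (intro inverse_ln_bounds) auto
  qed (use * in auto)
  then have "li_sum (upper_index N) < li_sum (lower_index N)"
    using li_sum_diff[of "upper_index N" "lower_index N"] upper_index(1)[of N] * by auto
  then show False using lower_index(3)[of N] upper_index(2)[of N] N by linarith
qed

lemma filterlim_lower_index: "filterlim lower_index at_top sequentially"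
proof -
  have "li_sum m \<le> real m" for m
  proof -
    have "li_sum m \<le> (\<Sum>n=3..<m. 1)"
      unfolding li_sum_def by (intro sum_mono inverse_ln_bounds) auto
    then show ?thesis by simp
  qed
  then have le: "\<forall>N. real N - real N powr (3/4) \<le> real (lower_index N)"
    using lower_index(2) order_trans by blast
  have "filterlim (\<lambda>N. real N - real N powr (3/4)) at_top sequentially" by real_asymp
  then have lim: "filterlim (\<lambda>N. real (lower_index N)) at_top sequentially"
    by (rule filterlim_at_top_mono) (rule always_eventually[OF le])
  show ?thesis
    unfolding filterlim_at_top
  proof
    fix m :: nat
    have "\<forall>\<^sub>F N in sequentially. real m \<le> real (lower_index N)"
      using lim unfolding filterlim_at_top by blast
    then show "\<forall>\<^sub>F N in sequentially. m \<le> lower_index N" by simp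
  qed
qed

lemma li_sum_lower_index_asymp: "(\<lambda>N. li_sum (lower_index N) / real N) \<longlonglongrightarrow> 1"
proof (rule tendsto_sandwich)
  show "(\<lambda>N. (real N - real N powr (3/4)) / real N) \<longlonglongrightarrow> 1" by real_asymp
  show "(\<lambda>N. (real N - real N powr (3/4) + 1) / real N) \<longlonglongrightarrow> 1" by real_asymp
qed (auto intro!: always_eventually divide_right_mono lower_index)

section \<open>Convergence of the normalised sum\<close>

context pseudo_prime_model
begin

text \<open>The character enters only through its periodic real part \<open>c\<close>, with mean 0
  and mean square \<open>s\<close> over a period.\<close>

lemma weak_conv_normalized_cos_sum:
  fixes c \<theta> :: "nat \<Rightarrow> real"
  assumes k: "k > 0" and c: "\<And>n. c n = (if coprime n k then cos (\<theta> n) else 0)"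
    and per: "\<And>n. c (n + k) = c n" and mean: "(\<Sum>n<k. c n) = 0"
    and mean2: "(\<Sum>n<k. (c n)\<^sup>2) = real k * s" and s: "s > 0"
  shows "weak_conv_m (\<lambda>N. distr M borel (\<lambda>\<omega>. clt_scale s N * pseudo_prime_cos_sum r k \<theta> N \<omega>))
    std_normal_distribution"
proof -
  define a where "a = lower_index"
  define b where "b = upper_index"
  define C where "C = clt_scale s"
  define q where "q N = real N powr (3/4)" for N
  \<comment> \<open>\<open>W\<close> is the normalised sum, \<open>Y\<close> its centered part
    before the deterministic index, and \<open>C N * U N\<close> the contribution of the window up
    to the random index.\<close>
  define W where "W N \<omega> = C N * pseudo_prime_cos_sum r k \<theta> N \<omega>" for N \<omega>
  define Y where "Y N \<omega> = (\<Sum>n=3..<a N. C N * centered_term c n (r n \<omega>))" for N \<omega>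
  define U where "U N \<omega> = (\<Sum>n=a N..<b N.
    (if pseudo_prime_count n (\<lambda>n. r n \<omega>) < real N then 1 else 0) * centered_term c n (r n \<omega>))" for N \<omega>
  note ab_defs = a_def b_def q_def
  have c1: "\<bar>c n\<bar> \<le> 1" for n by (simp add: c)
  have a3: "3 \<le> a N" and b3: "3 \<le> b N" for N using lower_index upper_index by (auto simp: ab_defs)
  have C: "C \<longlonglongrightarrow> 0" "(\<lambda>N. (C N)\<^sup>2 * real N) \<longlonglongrightarrow> 1 / s"
    "(\<lambda>N. (C N)\<^sup>2 * (2 * q N + 1)) \<longlonglongrightarrow> 0"
    using clt_scale_asymp[OF s] by (simp_all add: C_def q_def)
  obtain K where K: "\<And>m. \<bar>\<Sum>n=3..<m. c n * (1 / ln (real n))\<bar> \<le> K"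
  proof (rule sum_periodic_antimono_bounded[of k c 3 "\<lambda>n. 1 / ln (real n)", OF k per mean])
    show "1 / ln (real (Suc n)) \<le> 1 / ln (real n)" if "n \<ge> 3" for n
      using that by (intro inverse_ln_antimono) auto
  qed (use inverse_ln_bounds in \<open>auto intro: less_imp_le\<close>)

  have rv_term: "random_variable borel (\<lambda>\<omega>. y * centered_term c n (r n \<omega>))" if "n \<ge> 3" for n y
    using rv[OF that] by measurable
  have rvW: "random_variable borel (W N)" for N
    unfolding W_def using borel_measurable_pseudo_prime_cos_sum by measurable
  have rvY: "random_variable borel (Y N)" for N
    unfolding Y_def by (intro borel_measurable_sum rv_term) simp
  have rvU: "random_variable borel (U N)" for N
    unfolding U_def by (rule borel_measurable_transform[OF a3])

  have conv_Y: "(\<lambda>N. char (distr M borel (Y N)) t) \<longlonglongrightarrow> char std_normal_distribution t" for t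
    unfolding Y_def
  proof (rule char_sum_tendsto_std_normal[where w = "\<lambda>N. \<bar>C N\<bar>"])
    fix N
    show "indep_vars (\<lambda>_. borel) (\<lambda>n \<omega>. C N * centered_term c n (r n \<omega>)) {3..<a N}"
      by (rule indep_vars_compose2[OF indep_vars_subset[OF indep]]) auto
    fix n assume n: "n \<in> {3..<a N}"
    then show "expectation (\<lambda>\<omega>. C N * centered_term c n (r n \<omega>)) = 0"
      by (simp add: expectation_centered_term)
    fix \<omega>
    show "\<bar>C N * centered_term c n (r n \<omega>)\<bar> \<le> \<bar>C N\<bar>"
      using n c1 by (simp add: abs_mult mult_left_le abs_centered_term_le)
  next
    show "(\<lambda>N. \<bar>C N\<bar>) \<longlonglongrightarrow> 0" using C(1) by (rule tendsto_rabs_zero)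
    let ?V = "\<lambda>m. \<Sum>n=3..<m. (c n)\<^sup>2 * (1 / ln (real n) - (1 / ln (real n))\<^sup>2)"
    have "(\<lambda>m. ?V m / li_sum m) \<longlonglongrightarrow> s"
      by (rule weighted_variance_asymp[OF k]) (use per mean2 c1 in \<open>auto simp: abs_square_le_1\<close>)
    then have "(\<lambda>N. ?V (a N) / li_sum (a N)) \<longlonglongrightarrow> s"
      unfolding a_def by (rule filterlim_compose[OF _ filterlim_lower_index])
    \<comment> \<open>The total variance is split into three factors with known limits 1/s, 1 and
      s.\<close>
    then have "(\<lambda>N. (C N)\<^sup>2 * real N * (li_sum (a N) / real N) * (?V (a N) / li_sum (a N))) \<longlonglongrightarrow> 1 / s * 1 * s"
      using li_sum_lower_index_asymp by (intro tendsto_mult C) (simp_all add: a_def)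
    moreover have "\<forall>\<^sub>F N in sequentially. (C N)\<^sup>2 * real N * (li_sum (a N) / real N) * (?V (a N) / li_sum (a N))
        = (C N)\<^sup>2 * ?V (a N)"
    proof -
      have "\<forall>\<^sub>F N in sequentially. real N - q N > 0" unfolding q_def by real_asymp
      then show ?thesis using eventually_gt_at_top[of 0]
      proof eventually_elim
        case (elim N)
        then have "li_sum (a N) > 0" using lower_index(2)[of N] by (simp add: ab_defs)
        then show ?case using elim by simp
      qed
    qed
    ultimately have "(\<lambda>N. (C N)\<^sup>2 * ?V (a N)) \<longlonglongrightarrow> 1" using s by (simp add: tendsto_cong)
    then show "(\<lambda>N. \<Sum>n=3..<a N. expectation (\<lambda>\<omega>. (C N * centered_term c n (r n \<omega>))\<^sup>2)) \<longlonglongrightarrow> 1"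
      by (simp add: power_mult_distrib second_moment_centered_term sum_distrib_left)
  qed auto

  have conv_diff: "(\<lambda>N. prob {\<omega>\<in>space M. e \<le> \<bar>W N \<omega> - Y N \<omega>\<bar>}) \<longlonglongrightarrow> 0" if e: "e > 0" for e
  proof -
    \<comment> \<open>The first two terms bound the probability that the random index leaves the
      window on either side; the third bounds a large contribution from within the window.\<close>
    let ?bound = "\<lambda>N. (real N - q N + 1) / (q N - 1)\<^sup>2 + (real N + q N + 1) / (q N)\<^sup>2
      + (C N)\<^sup>2 * (2 * q N + 1) / (e / 2)\<^sup>2"
    have "(\<lambda>N. \<bar>C N\<bar> * K) \<longlonglongrightarrow> 0"
      by (rule tendsto_mult_left_zero[OF tendsto_rabs_zero[OF C(1)]])
    then have "\<forall>\<^sub>F N in sequentially. \<bar>C N\<bar> * K < e / 2"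
      using e by (intro order_tendstoD(2)) auto
    moreover have "\<forall>\<^sub>F N in sequentially. q N > 1" unfolding q_def by real_asymp
    ultimately have "\<forall>\<^sub>F N in sequentially. prob {\<omega>\<in>space M. e \<le> \<bar>W N \<omega> - Y N \<omega>\<bar>} \<le> ?bound N"
      using eventually_ge_at_top[of 1]
    proof eventually_elim
      case (elim N)
      \<comment> \<open>The threshold is \<open>q N - 1\<close> because \<open>li_sum (a N)\<close>
        may exceed \<open>real N - q N\<close> by up to 1.\<close>
      define A1 where "A1 = {\<omega>\<in>space M. q N - 1 \<le> \<bar>pseudo_prime_count (a N) (\<lambda>n. r n \<omega>) - li_sum (a N)\<bar>}"
      define A2 where "A2 = {\<omega>\<in>space M. q N \<le> \<bar>pseudo_prime_count (b N) (\<lambda>n. r n \<omega>) - li_sum (b N)\<bar>}"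
      define A3 where "A3 = {\<omega>\<in>space M. e / 2 \<le> \<bar>C N * U N \<omega>\<bar>}"
      have ev: "A1 \<in> events" "A2 \<in> events" "A3 \<in> events"
        using borel_measurable_count rvU unfolding A1_def A2_def A3_def by measurable
      \<comment> \<open>Off \<open>A1\<close> and \<open>A2\<close> the pathwise decomposition
        applies; off \<open>A3\<close> the window part and the centering error are each below
        \<open>e / 2\<close>.\<close>
      have "{\<omega>\<in>space M. e \<le> \<bar>W N \<omega> - Y N \<omega>\<bar>} \<subseteq> A1 \<union> A2 \<union> A3"
      proof (rule subsetI, rule ccontr)
        fix \<omega> assume \<omega>: "\<omega> \<in> {\<omega>\<in>space M. e \<le> \<bar>W N \<omega> - Y N \<omega>\<bar>}" and n: "\<omega> \<notin> A1 \<union> A2 \<union> A3"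
        have "pseudo_prime_count (a N) (\<lambda>n. r n \<omega>) < real N"
          using \<omega> n lower_index(3)[of N] by (auto simp: A1_def ab_defs)
        moreover have "real N \<le> pseudo_prime_count (b N) (\<lambda>n. r n \<omega>)"
          using \<omega> n upper_index(2)[of N] by (auto simp: A2_def ab_defs)
        ultimately have "\<bar>pseudo_prime_cos_sum r k \<theta> N \<omega>
            - (\<Sum>n=3..<a N. centered_term c n (r n \<omega>)) - U N \<omega>\<bar> \<le> K"
          unfolding U_def by (intro pseudo_prime_cos_sum_decomposition elim a3 c K)
        then have "\<bar>C N\<bar> * \<bar>pseudo_prime_cos_sum r k \<theta> N \<omega>
            - (\<Sum>n=3..<a N. centered_term c n (r n \<omega>)) - U N \<omega>\<bar> \<le> \<bar>C N\<bar> * K"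
          by (intro mult_left_mono) auto
        also have "\<bar>C N\<bar> * \<bar>pseudo_prime_cos_sum r k \<theta> N \<omega>
            - (\<Sum>n=3..<a N. centered_term c n (r n \<omega>)) - U N \<omega>\<bar> = \<bar>W N \<omega> - Y N \<omega> - C N * U N \<omega>\<bar>"
          by (simp add: W_def Y_def right_diff_distrib sum_distrib_left flip: abs_mult)
        finally have "\<bar>W N \<omega> - Y N \<omega> - C N * U N \<omega>\<bar> < e / 2" using elim by simp
        moreover have "\<bar>C N * U N \<omega>\<bar> < e / 2" using \<omega> n by (auto simp: A3_def)
        moreover have "e \<le> \<bar>W N \<omega> - Y N \<omega>\<bar>" using \<omega> by simp
        ultimately show False by linarith
      qed
      then have "prob {\<omega>\<in>space M. e \<le> \<bar>W N \<omega> - Y N \<omega>\<bar>} \<le> prob (A1 \<union> A2 \<union> A3)"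
        using ev by (intro finite_measure_mono) auto
      also have "\<dots> \<le> prob A1 + prob A2 + prob A3"
        using measure_Un_le[of "A1 \<union> A2" M A3] measure_Un_le[of A1 M A2] ev by auto
      also have "\<dots> \<le> ?bound N"
      proof (intro add_mono)
        have "prob A1 \<le> li_sum (a N) / (q N - 1)\<^sup>2"
          unfolding A1_def using elim by (intro prob_count_deviation_le a3) simp
        also have "\<dots> \<le> (real N - q N + 1) / (q N - 1)\<^sup>2"
          using lower_index(3)[of N] by (intro divide_right_mono) (auto simp: ab_defs)
        finally show "prob A1 \<le> (real N - q N + 1) / (q N - 1)\<^sup>2" .
        have "prob A2 \<le> li_sum (b N) / (q N)\<^sup>2"
          unfolding A2_def using elim by (intro prob_count_deviation_le b3) simp
        also have "\<dots> \<le> (real N + q N + 1) / (q N)\<^sup>2"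
          using upper_index(3)[of N] by (intro divide_right_mono) (auto simp: ab_defs)
        finally show "prob A2 \<le> (real N + q N + 1) / (q N)\<^sup>2" .
        have "prob A3 \<le> (C N)\<^sup>2 * (li_sum (b N) - li_sum (a N)) / (e / 2)\<^sup>2"
          unfolding A3_def U_def
          by (rule prob_transform_le[OF a3 _ c1]) (use e elim lower_index_le_upper_index in \<open>auto simp: ab_defs\<close>)
        also have "\<dots> \<le> (C N)\<^sup>2 * (2 * q N + 1) / (e / 2)\<^sup>2"
          using lower_index(2)[of N] upper_index(3)[of N]
          by (intro divide_right_mono mult_left_mono) (auto simp: ab_defs)
        finally show "prob A3 \<le> (C N)\<^sup>2 * (2 * q N + 1) / (e / 2)\<^sup>2" .
      qed
      finally show ?case .
    qed
    \<comment> \<open>The exponent 3/4 exceeds 1/2, so N / (q N)^2 tends to 0, and is below 1, so q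
      N / N tends to 0.\<close>
    moreover have "?bound \<longlonglongrightarrow> 0"
    proof -
      have 1: "(\<lambda>N. (real N - q N + 1) / (q N - 1)\<^sup>2) \<longlonglongrightarrow> 0"
        unfolding q_def by real_asymp
      have 2: "(\<lambda>N. (real N + q N + 1) / (q N)\<^sup>2) \<longlonglongrightarrow> 0"
        unfolding q_def by real_asymp
      have 3: "(\<lambda>N. (C N)\<^sup>2 * (2 * q N + 1) / (e / 2)\<^sup>2) \<longlonglongrightarrow> 0"
        by (rule tendsto_divide_zero[OF C(3)])
      show ?thesis by (rule tendsto_add_zero[OF tendsto_add_zero[OF 1 2] 3])
    qed
    ultimately show ?thesis
      by (rule tendsto_sandwich[OF always_eventually _ tendsto_const, rotated]) simp
  qed

  have "weak_conv_m (\<lambda>N. distr M borel (W N)) std_normal_distribution"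
  proof (rule levy_continuity)
    show "(\<lambda>N. char (distr M borel (W N)) t) \<longlonglongrightarrow> char std_normal_distribution t" for t
      using conv_Y char_distr_diff_tendsto_0[OF rvW rvY conv_diff] by (rule Lim_transform)
  qed (use rvW real_dist_normal_dist in auto)
  then show ?thesis by (simp add: W_def[abs_def] C_def)
qed

end

theorem theorem1:
  fixes k :: nat and chi :: "nat \<Rightarrow> complex" and \<theta> :: "nat \<Rightarrow> real"
    and M :: "'a measure" and r :: "nat \<Rightarrow> 'a \<Rightarrow> real"
  assumes "dirichlet_character k chi" and "chi \<noteq> principal_character k"
    and "\<And>n. chi n \<noteq> 0 \<Longrightarrow> chi n = exp (\<i> * complex_of_real (\<theta> n))"
    and "prob_space M"
    and "prob_space.indep_vars M (\<lambda>_. borel) r {3..}"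
    and "\<And>n. n \<ge> 3 \<Longrightarrow> distr M borel (r n) = uniform_measure lborel {0..1}"
  shows "weak_conv_m
           (\<lambda>N. distr M borel (\<lambda>\<omega>.
              sqrt ((1 + ln (ln (real N)) / ln (real N)) / (character_variance k chi * real N))
                * pseudo_prime_cos_sum r k \<theta> N \<omega>))
           std_normal_distribution"
proof -
  interpret prob_space M by fact
  interpret pseudo_prime_model M r
    by unfold_locales (use assms(5,6) in auto)
  from assms(1) have k: "k > 0" and per: "\<And>n. chi (n + k) = chi n"
    and nz: "\<And>n. chi n \<noteq> 0 \<longleftrightarrow> coprime n k"
    by (auto simp: dirichlet_character_def)
  have unit: "cmod (chi n) = 1" if "chi n \<noteq> 0" for n
    by (subst assms(3)[OF that]) simp
  \<comment> \<open>Off the units the real part is 0, in agreement with the coprimality condition in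
    the summands; there the value of \<theta> is immaterial.\<close>
  have c: "Re (chi n) = (if coprime n k then cos (\<theta> n) else 0)" for n
  proof (cases "coprime n k")
    case True
    then have "chi n = exp (\<i> * complex_of_real (\<theta> n))" using nz assms(3) by blast
    then show ?thesis using True by (simp add: Re_exp)
  next
    case False
    then have "chi n = 0" using nz by blast
    then show ?thesis using False by simp
  qed
  have s: "character_variance k chi > 0" using k by (simp add: character_variance_def)
  have "weak_conv_m (\<lambda>N. distr M borel (\<lambda>\<omega>.
      clt_scale (character_variance k chi) N * pseudo_prime_cos_sum r k \<theta> N \<omega>)) std_normal_distribution"
  proof (rule weak_conv_normalized_cos_sum[where c = "\<lambda>n. Re (chi n)", OF k c _ _ _ s])
    show "Re (chi (n + k)) = Re (chi n)" for n by (simp only: per)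
    show "(\<Sum>n<k. Re (chi n)) = 0"
      using assms(1,2) unit by (rule sum_Re_dirichlet_character)
    show "(\<Sum>n<k. (Re (chi n))\<^sup>2) = real k * character_variance k chi"
      using assms(1,2) unit by (rule sum_Re_power2_dirichlet_character)
  qed
  then show ?thesis unfolding clt_scale_def .
qed

end
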